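(* There exist constants $c_1,c_2,c_3>0$ such that for every sufficiently large $n$ there is a family of $\Gamma=2^{\Theta(n)}$ games $G_i=(A_i,B_i)$, $i=1,\dots,\Gamma$ (in particular $\Gamma\ge 2^{c_1 n}$), each with $n$ pure strategies for both players and all payoffs in $[-1,1]$, such that: (1) (Completeness) there is a single pseudo-distribution of degree at least $c_2 n$ which is a pseudo-equilibrium of every $G_i$ simultaneously; (2) (Soundness) with $\varepsilon=c_3/n^4$, for any $i\neq j$, if $(x,y)$ is an $\varepsilon$-NE of $G_i$ and $(x',y')$ is an $\varepsilon$-NE of $G_j$, then $x\neq x'$ and $y\neq y'$.
   Context: A two-player game with $n$ strategies is a pair $(A,B)$ of matrices in $\mathbb{R}^{n\times n}$ (payoffs of the row and column player). Mixed strategies are elements of $\Delta_n=\{x\in[0,1]^n:\sum_i x_i=1\}$; $e_i$ is the $i$-th pure strategy. $(x,y)\in\Delta_n\times\Delta_n$ is an $\varepsilon$-NE if $x^\top Ay\ge e_i^\top Ay-\varepsilon$ and $x^\top By\ge x^\top Be_j-\varepsilon$ for all $i,j$. A degree-$d$ pseudo-distribution on $\mathbb{R}^m$ is a finitely supported signed measure $\tilde\mu$ whose functional $\tilde{\mathbb E}[f]=\sum_z\tilde\mu(z)f(z)$ satisfies $\tilde{\mathbb E}[1]=1$ and $\tilde{\mathbb E}[q^2]\ge0$ for all polynomials $q$ of degree $\le d/2$; it satisfies $h\ge0$ if $\tilde{\mathbb E}[p^2h]\ge0$ for all polynomials $p$ with $\deg(p^2h)\le d$ ($h=0$ means $h\ge0$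 and $-h\ge0$). A degree-$d$ pseudo-equilibrium of $(A,B)$ is a degree-$d$ pseudo-distribution over $(x,y)\in\mathbb{R}^{2n}$ satisfying $x_i,y_i\ge0$, $\sum_ix_i=\sum_iy_i=1$, $x^\top Ay-e_i^\top Ay\ge0$ and $x^\top By-x^\top Be_j\ge0$ for all $i,j$. *)

theory Defs
  imports
    Complex_Main
    "HOL-Library.Poly_Mapping"
    "HOL-Library.Landau_Symbols"
    "Jordan_Normal_Form.Matrix"
begin

section \<open>Two-player games\<close>

type_synonym game = "real mat \<times> real mat"

definition is_game :: "nat \<Rightarrow> game \<Rightarrow> bool" where
  "is_game n G \<longleftrightarrow> fst G \<in> carrier_mat n n \<and> snd G \<in> carrier_mat n n"

definition payoffs_in :: "real set \<Rightarrow> game \<Rightarrow> bool" where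
  "payoffs_in S G \<longleftrightarrow> elements_mat (fst G) \<subseteq> S \<and> elements_mat (snd G) \<subseteq> S"

definition mixed_strategies :: "nat \<Rightarrow> real vec set" where
  "mixed_strategies n =
     {x \<in> carrier_vec n. (\<forall>i<n. x $ i \<in> {0..1}) \<and> (\<Sum>i<n. x $ i) = 1}"

definition eps_NE :: "nat \<Rightarrow> real \<Rightarrow> game \<Rightarrow> real vec \<Rightarrow> real vec \<Rightarrow> bool" where
  "eps_NE n \<epsilon> G x y \<longleftrightarrow>
     x \<in> mixed_strategies n \<and> y \<in> mixed_strategies n \<and>
     (\<forall>i<n. x \<bullet> (fst G *\<^sub>v y) \<ge> unit_vec n i \<bullet> (fst G *\<^sub>v y) - \<epsilon>) \<and>
     (\<forall>j<n. x \<bullet> (snd G *\<^sub>v y) \<ge> x \<bullet> (snd G *\<^sub>v unit_vec n j) - \<epsilon>)"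


section \<open>Real multivariate polynomials\<close>

text \<open>A polynomial is a finitely supported map from monomials to coefficients, a monomial being a
  finitely supported map from variable indices to exponents; the ring structure is the convolution
  structure on such maps. Convention: the zero polynomial has total degree 0.\<close>

type_synonym rpoly = "(nat \<Rightarrow>\<^sub>0 nat) \<Rightarrow>\<^sub>0 real"

definition pvar :: "nat \<Rightarrow> rpoly" where
  "pvar k = Poly_Mapping.single (Poly_Mapping.single k 1) 1"

definition pconst :: "real \<Rightarrow> rpoly" where
  "pconst c = Poly_Mapping.single 0 c"

definition rpolys :: "nat \<Rightarrow> rpoly set" where
  "rpolys m = {p. \<forall>t \<in> Poly_Mapping.keys p. Poly_Mapping.keys t \<subseteq> {..<m}}"

definition total_degree :: "rpoly \<Rightarrow> nat" where
  "total_degree p =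
     Max (insert 0 ((\<lambda>t. \<Sum>k\<in>Poly_Mapping.keys t. Poly_Mapping.lookup t k) ` Poly_Mapping.keys p))"

definition peval :: "rpoly \<Rightarrow> real vec \<Rightarrow> real" where
  "peval p z = (\<Sum>t\<in>Poly_Mapping.keys p. Poly_Mapping.lookup p t *
                  (\<Prod>k\<in>Poly_Mapping.keys t. (z $ k) ^ Poly_Mapping.lookup t k))"


section \<open>Pseudo-distributions\<close>

text \<open>A finitely supported signed measure is given by its point masses.\<close>

definition finite_signed_measure :: "nat \<Rightarrow> (real vec \<Rightarrow> real) \<Rightarrow> bool" where
  "finite_signed_measure m \<mu> \<longleftrightarrow> finite {z. \<mu> z \<noteq> 0} \<and> {z. \<mu> z \<noteq> 0} \<subseteq> carrier_vec m"

definition pseudo_expectation :: "(real vec \<Rightarrow> real) \<Rightarrow> rpoly \<Rightarrow> real" where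
  "pseudo_expectation \<mu> f = (\<Sum>z | \<mu> z \<noteq> 0. \<mu> z * peval f z)"

definition pseudo_distribution :: "nat \<Rightarrow> nat \<Rightarrow> (real vec \<Rightarrow> real) \<Rightarrow> bool" where
  "pseudo_distribution m d \<mu> \<longleftrightarrow>
     finite_signed_measure m \<mu> \<and>
     pseudo_expectation \<mu> 1 = 1 \<and>
     (\<forall>q \<in> rpolys m. real (total_degree q) \<le> real d / 2 \<longrightarrow> pseudo_expectation \<mu> (q ^ 2) \<ge> 0)"

definition satisfies_ge0 :: "nat \<Rightarrow> nat \<Rightarrow> (real vec \<Rightarrow> real) \<Rightarrow> rpoly \<Rightarrow> bool" where
  "satisfies_ge0 m d \<mu> h \<longleftrightarrow>
     (\<forall>p \<in> rpolys m. total_degree (p ^ 2 * h) \<le> d \<longrightarrow> pseudo_expectation \<mu> (p ^ 2 * h) \<ge> 0)"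

definition satisfies_eq0 :: "nat \<Rightarrow> nat \<Rightarrow> (real vec \<Rightarrow> real) \<Rightarrow> rpoly \<Rightarrow> bool" where
  "satisfies_eq0 m d \<mu> h \<longleftrightarrow> satisfies_ge0 m d \<mu> h \<and> satisfies_ge0 m d \<mu> (- h)"


section \<open>Pseudo-equilibria\<close>

text \<open>A point \<open>(x, y)\<close> of dimension \<open>2 * n\<close> is the concatenation of \<open>x\<close> and \<open>y\<close>, so the
  coordinate variables of \<open>y\<close> are shifted by \<open>n\<close>.\<close>

definition xvar :: "nat \<Rightarrow> nat \<Rightarrow> rpoly" where
  "xvar n i = pvar i"

definition yvar :: "nat \<Rightarrow> nat \<Rightarrow> rpoly" where
  "yvar n j = pvar (n + j)"

text \<open>The polynomials \<open>x\<^sup>T M y\<close>, \<open>e\<^sub>i\<^sup>T M y\<close> and \<open>x\<^sup>T M e\<^sub>j\<close>.\<close>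

definition bilin_poly :: "nat \<Rightarrow> real mat \<Rightarrow> rpoly" where
  "bilin_poly n M = (\<Sum>i<n. \<Sum>j<n. pconst (M $$ (i, j)) * xvar n i * yvar n j)"

definition row_poly :: "nat \<Rightarrow> real mat \<Rightarrow> nat \<Rightarrow> rpoly" where
  "row_poly n M i = (\<Sum>j<n. pconst (M $$ (i, j)) * yvar n j)"

definition col_poly :: "nat \<Rightarrow> real mat \<Rightarrow> nat \<Rightarrow> rpoly" where
  "col_poly n M j = (\<Sum>i<n. pconst (M $$ (i, j)) * xvar n i)"

definition pseudo_equilibrium :: "nat \<Rightarrow> nat \<Rightarrow> game \<Rightarrow> (real vec \<Rightarrow> real) \<Rightarrow> bool" where
  "pseudo_equilibrium n d G \<mu> \<longleftrightarrow>
     pseudo_distribution (2 * n) d \<mu> \<and>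
     (\<forall>i<n. satisfies_ge0 (2 * n) d \<mu> (xvar n i)) \<and>
     (\<forall>i<n. satisfies_ge0 (2 * n) d \<mu> (yvar n i)) \<and>
     satisfies_eq0 (2 * n) d \<mu> ((\<Sum>i<n. xvar n i) - 1) \<and>
     satisfies_eq0 (2 * n) d \<mu> ((\<Sum>i<n. yvar n i) - 1) \<and>
     (\<forall>i<n. satisfies_ge0 (2 * n) d \<mu> (bilin_poly n (fst G) - row_poly n (fst G) i)) \<and>
     (\<forall>j<n. satisfies_ge0 (2 * n) d \<mu> (bilin_poly n (snd G) - col_poly n (snd G) j))"

end

theory Submission
  imports Defs "HOL-Computational_Algebra.Polynomial"
begin

text \<open>All games share a block of \<open>2 * N\<close> strategies, the literals of \<open>N\<close> bits. Inside it the row player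
  wants to play the same literal as the column player, and the column player wants to avoid the row
  player's bit, so both spread evenly over the bits and settle on a common assignment. Two kinds of further rows
  bet that the number of ones is above, respectively below, a half-integer \<open>r\<close>. One of these bets always
  pays off, so no real equilibrium stays in the block; the knapsack pseudo-distribution of degree
  \<open>\<Omega>(N)\<close>, under which exactly \<open>r\<close> bits are one, does not notice. Real equilibria are thus driven to
  the remaining strategies, where a weighted matching-pennies game, absent from the support of the
  pseudo-distribution, makes both players mix in inverse proportion to the weights. The
  exponentially many choices of weights in \<open>{1/2, 1}\<close> give the family.\<close>

text \<open>On the support the two bets pay \<open>1 / N\<close> plus or minus
  \<open>excess / (2 * N)\<close>. For a true assignment the half-integer \<open>r\<close> makes
  \<open>excess\<close> at least 1/2 in absolute value, so one bet gains an amount of order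
  \<open>1 / N\<close>; the pseudo-expectation annihilates multiples of \<open>excess\<close> of low
  degree and sees no gain. All other regrets are constants times squares on the support, so
  completeness reduces to nonnegativity on squares. Weights occur only where both players leave the
  literals, hence one pseudo-distribution serves every game. The obstacle in soundness is an
  approximate equilibrium that imitates a fractional number of ones. A payoff error
  \<open>\<epsilon>\<close> becomes an error of order \<open>N * \<epsilon>\<close> in the
  probability of a literal, and of order \<open>N ^ 2 * \<epsilon>\<close> after summing over the
  bits. It must stay below the gap of order \<open>1 / N\<close>, which asks for
  \<open>\<epsilon>\<close> of order \<open>1 / N ^ 3\<close>. Telling two weightings apart asks for
  order \<open>1 / n ^ 2\<close>; the bound \<open>1 / n ^ 4\<close> covers both.\<close>

subsection \<open>Substitution homomorphisms and the total degree\<close>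

text \<open>Evaluation at a point and the grading by total degree both have this shape, so
  multiplicativity is proved once for the two.\<close>

locale poly_mapping_hom =
  fixes e :: "'b::comm_semiring_1 \<Rightarrow> 'c::comm_semiring_1" and m :: "'a::comm_monoid_add \<Rightarrow> 'c"
  assumes e_0: "e 0 = 0" and e_add: "e (a + b) = e a + e b" and e_mult: "e (a * b) = e a * e b"
    and m_add: "m (s + t) = m s * m t"
begin

definition ext :: "('a \<Rightarrow>\<^sub>0 'b) \<Rightarrow> 'c" where
  "ext p = (\<Sum>t\<in>Poly_Mapping.keys p. e (Poly_Mapping.lookup p t) * m t)"

lemma ext_superset:
  assumes "finite F" "Poly_Mapping.keys p \<subseteq> F"
  shows "ext p = (\<Sum>t\<in>F. e (Poly_Mapping.lookup p t) * m t)"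
  unfolding ext_def using assms
  by (intro sum.mono_neutral_left) (auto simp: e_0 in_keys_iff)

lemma ext_0: "ext 0 = 0"
  by (simp add: ext_def)

lemma ext_single: "ext (Poly_Mapping.single t c) = e c * m t"
  by (subst ext_superset[of "{t}"]) auto

lemma ext_add: "ext (p + q) = ext p + ext q"
proof -
  define F where "F = Poly_Mapping.keys p \<union> Poly_Mapping.keys q"
  have "ext (p + q) = (\<Sum>t\<in>F. e (Poly_Mapping.lookup (p + q) t) * m t)"
    by (rule ext_superset) (use keys_add[of p q] in \<open>auto simp: F_def\<close>)
  also have "\<dots> = (\<Sum>t\<in>F. e (Poly_Mapping.lookup p t) * m t) + (\<Sum>t\<in>F. e (Poly_Mapping.lookup q t) * m t)"
    by (simp add: lookup_add e_add distrib_right sum.distrib)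
  also have "\<dots> = ext p + ext q"
    by (simp add: ext_superset[of F p] ext_superset[of F q] F_def)
  finally show ?thesis .
qed

lemma ext_sum: "ext (sum f A) = (\<Sum>a\<in>A. ext (f a))"
  by (induction A rule: infinite_finite_induct) (auto simp: ext_0 ext_add)

lemma sum_singles: "p = (\<Sum>t\<in>Poly_Mapping.keys p. Poly_Mapping.single t (Poly_Mapping.lookup p t))"
  by (rule poly_mapping_eqI) (auto simp: lookup_sum lookup_single when_def in_keys_iff sum.delta)

lemma ext_mult: "ext (p * q) = ext p * ext q"
proof -
  have "p * q = (\<Sum>s\<in>Poly_Mapping.keys p. \<Sum>t\<in>Poly_Mapping.keys q.
      Poly_Mapping.single (s + t) (Poly_Mapping.lookup p s * Poly_Mapping.lookup q t))"
    by (subst sum_singles[of p], subst sum_singles[of q]) (simp add: sum_product mult_single)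
  then show ?thesis
    by (simp add: ext_sum ext_single e_mult m_add) (simp add: ext_def sum_product mult_ac)
qed

end

section \<open>Additivity of the total degree\<close>

definition monomial_degree :: "(nat \<Rightarrow>\<^sub>0 nat) \<Rightarrow> nat" where
  "monomial_degree t = (\<Sum>k\<in>Poly_Mapping.keys t. Poly_Mapping.lookup t k)"

lemma monomial_degree_superset:
  assumes "finite F" "Poly_Mapping.keys t \<subseteq> F"
  shows "monomial_degree t = (\<Sum>k\<in>F. Poly_Mapping.lookup t k)"
  unfolding monomial_degree_def using assms
  by (intro sum.mono_neutral_left) (auto simp: in_keys_iff)

lemma monomial_degree_add: "monomial_degree (s + t) = monomial_degree s + monomial_degree t"
proof -
  define F where "F = Poly_Mapping.keys s \<union> Poly_Mapping.keys t"
  have "monomial_degree (s + t) = (\<Sum>k\<in>F. Poly_Mapping.lookup (s + t) k)"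
    by (rule monomial_degree_superset) (use keys_add[of s t] in \<open>auto simp: F_def\<close>)
  then show ?thesis
    by (simp add: lookup_add sum.distrib monomial_degree_superset[of F s]
        monomial_degree_superset[of F t] F_def)
qed

text \<open>Marking each monomial with a power of an extra variable turns the total degree into the degree
  of a univariate polynomial over an integral domain.\<close>

interpretation grade: poly_mapping_hom "\<lambda>c. [:pconst c:]"
    "\<lambda>t. monom (Poly_Mapping.single t (1::real)) (monomial_degree t)"
  by unfold_locales
    (simp_all add: pconst_def single_add mult_single mult_monom monomial_degree_add mult.commute)

lemma lookup_coeff_grade:
  "Poly_Mapping.lookup (coeff (grade.ext p) n) t = (Poly_Mapping.lookup p t when monomial_degree t = n)"
proof -
  have "coeff (grade.ext p) n = (\<Sum>s\<in>Poly_Mapping.keys p.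
      if monomial_degree s = n then Poly_Mapping.single s (Poly_Mapping.lookup p s) else 0)"
    unfolding grade.ext_def coeff_sum
    by (rule sum.cong) (auto simp: pconst_def mult_single)
  then have "Poly_Mapping.lookup (coeff (grade.ext p) n) t = (\<Sum>s\<in>Poly_Mapping.keys p.
      Poly_Mapping.lookup (if monomial_degree s = n
        then Poly_Mapping.single s (Poly_Mapping.lookup p s) else 0) t)"
    by (simp add: lookup_sum)
  also have "\<dots> = (\<Sum>s\<in>Poly_Mapping.keys p.
      if s = t then (Poly_Mapping.lookup p t when monomial_degree t = n) else 0)"
    by (rule sum.cong) (auto simp: lookup_single when_def)
  also have "\<dots> = (Poly_Mapping.lookup p t when monomial_degree t = n)"
    by (auto simp: in_keys_iff when_def)
  finally show ?thesis .
qed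

lemma total_degree_le_iff:
  "total_degree p \<le> n \<longleftrightarrow> (\<forall>t\<in>Poly_Mapping.keys p. monomial_degree t \<le> n)"
  unfolding total_degree_def monomial_degree_def by auto

text \<open>Distinct monomials stay independent in the coefficient ring, so a nonzero homogeneous
  part never cancels.\<close>

lemma total_degree_eq_degree_grade: "total_degree p = degree (grade.ext p)"
proof (rule antisym)
  have "coeff (grade.ext p) (monomial_degree t) \<noteq> 0" if "t \<in> Poly_Mapping.keys p" for t
  proof
    assume "coeff (grade.ext p) (monomial_degree t) = 0"
    then have "Poly_Mapping.lookup p t = 0"
      using lookup_coeff_grade[of p "monomial_degree t" t] by simp
    with that show False by (simp add: in_keys_iff)
  qed
  then show "total_degree p \<le> degree (grade.ext p)"
    unfolding total_degree_le_iff by (blast intro: le_degree)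
  have "coeff (grade.ext p) k = 0" if "k > total_degree p" for k
  proof (rule poly_mapping_eqI)
    fix t
    show "Poly_Mapping.lookup (coeff (grade.ext p) k) t = Poly_Mapping.lookup 0 t"
      using that total_degree_le_iff[of p "total_degree p"]
      by (auto simp: lookup_coeff_grade when_def simp flip: not_in_keys_iff_lookup_eq_zero)
  qed
  then show "degree (grade.ext p) \<le> total_degree p"
    by (intro degree_le) simp
qed

lemma grade_eq_0_iff: "grade.ext p = 0 \<longleftrightarrow> p = 0"
proof
  assume *: "grade.ext p = 0"
  show "p = 0"
  proof (rule poly_mapping_eqI)
    fix t
    show "Poly_Mapping.lookup p t = Poly_Mapping.lookup 0 t"
      using lookup_coeff_grade[of p "monomial_degree t" t] * by simp
  qed
qed (simp add: grade.ext_0)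

lemma total_degree_mult:
  assumes "p \<noteq> 0" "q \<noteq> 0"
  shows "total_degree (p * q) = total_degree p + total_degree q"
  using assms
  by (simp add: total_degree_eq_degree_grade grade.ext_mult degree_mult_eq grade_eq_0_iff)

text \<open>\<open>satisfies_ge0\<close> bounds only the degree of the product, while positivity of
  \<open>L\<close> is governed by the degree of \<open>p\<close>. The bound passes to
  \<open>p\<close> because leading forms cannot cancel.\<close>

lemma total_degree_square_mult_le:
  assumes "total_degree (p ^ 2 * h) \<le> d" "h \<noteq> 0"
  shows "2 * total_degree p \<le> d"
proof (cases "p = 0")
  case False
  then have "p * p \<noteq> 0" by simp
  with False assms show ?thesis
    by (simp add: power2_eq_square total_degree_mult)
qed (simp add: total_degree_def)

section \<open>Evaluation of polynomials at a point\<close>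

definition meval :: "(nat \<Rightarrow>\<^sub>0 nat) \<Rightarrow> real vec \<Rightarrow> real" where
  "meval t z = (\<Prod>k\<in>Poly_Mapping.keys t. (z $ k) ^ Poly_Mapping.lookup t k)"

lemma meval_superset:
  assumes "finite F" "Poly_Mapping.keys t \<subseteq> F"
  shows "meval t z = (\<Prod>k\<in>F. (z $ k) ^ Poly_Mapping.lookup t k)"
  unfolding meval_def using assms
  by (intro prod.mono_neutral_left) (auto simp: in_keys_iff)

lemma meval_add: "meval (s + t) z = meval s z * meval t z"
proof -
  define F where "F = Poly_Mapping.keys s \<union> Poly_Mapping.keys t"
  have "meval (s + t) z = (\<Prod>k\<in>F. (z $ k) ^ Poly_Mapping.lookup (s + t) k)"
    by (rule meval_superset) (use keys_add[of s t] in \<open>auto simp: F_def\<close>)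
  then show ?thesis
    by (simp add: lookup_add power_add prod.distrib meval_superset[of F s] meval_superset[of F t] F_def)
qed

interpretation peval: poly_mapping_hom "\<lambda>c::real. c" "\<lambda>t. meval t z" for z
  by unfold_locales (simp_all add: meval_add distrib_right)

lemma peval_eq_ext: "peval p z = peval.ext z p"
  unfolding peval_def peval.ext_def by (simp only: meval_def)

lemma peval_add [simp]: "peval (p + q) z = peval p z + peval q z"
  by (simp add: peval_eq_ext peval.ext_add)

lemma peval_mult [simp]: "peval (p * q) z = peval p z * peval q z"
  by (simp add: peval_eq_ext peval.ext_mult)

lemma peval_sum [simp]: "peval (sum f A) z = (\<Sum>a\<in>A. peval (f a) z)"
  by (simp add: peval_eq_ext peval.ext_sum)

lemma peval_0 [simp]: "peval 0 z = 0"
  by (simp add: peval_def)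

lemma peval_pconst [simp]: "peval (pconst c) z = c"
  unfolding peval_eq_ext pconst_def peval.ext_single by (simp add: meval_def)

lemma peval_pvar [simp]: "peval (pvar k) z = z $ k"
  unfolding peval_eq_ext pvar_def peval.ext_single by (simp add: meval_def)

lemma peval_1 [simp]: "peval 1 z = 1"
  using peval_pconst[of 1 z] by (simp add: pconst_def)

lemma peval_uminus [simp]: "peval (- p) z = - peval p z"
  using peval_add[of p "- p" z] by simp

lemma peval_diff [simp]: "peval (p - q) z = peval p z - peval q z"
  using peval_add[of p "- q" z] by simp

lemma peval_power2 [simp]: "peval (p ^ 2) z = (peval p z) ^ 2"
  by (simp add: power2_eq_square)

subsection \<open>The knapsack pseudo-distribution\<close>

text \<open>The falling factorial, with a real base because \<open>r\<close> is a half-integer in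
  the games.\<close>

definition ffall :: "real \<Rightarrow> nat \<Rightarrow> real" where
  "ffall a k = (\<Prod>i<k. a - real i)"

lemma ffall_0 [simp]: "ffall a 0 = 1"
  by (simp add: ffall_def)

lemma ffall_Suc [simp]: "ffall a (Suc k) = ffall a k * (a - real k)"
  by (simp add: ffall_def)

lemma ffall_pos: "a > real k - 1 \<Longrightarrow> ffall a k > 0"
  unfolding ffall_def by (rule prod_pos) auto

lemma ffall_nonneg: "a \<ge> real k - 1 \<Longrightarrow> ffall a k \<ge> 0"
  unfolding ffall_def by (rule prod_nonneg) auto

definition ind :: "nat set \<Rightarrow> nat set \<Rightarrow> real" where
  "ind S T = (if S \<subseteq> T then 1 else 0)"

lemma ind_mult: "ind S T * ind S' T = ind (S \<union> S') T"
  by (auto simp: ind_def)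

locale knapsack =
  fixes N :: nat and r :: real
begin

text \<open>For a genuine slice (\<open>r\<close> an integer, all \<open>N\<close>-bit strings of weight \<open>r\<close> equally likely)
  this is the probability that \<open>s\<close> given bits are one and \<open>u\<close> further given bits are zero.\<close>

definition hyp :: "nat \<Rightarrow> nat \<Rightarrow> real" where
  "hyp s u = ffall r s * ffall (real N - r) u / ffall (real N) (s + u)"

text \<open>Conditioning on one further bit. The two cases add up since
  \<open>(r - s) + (N - r - u) = N - (s + u)\<close>, whether or not \<open>r\<close> is an
  integer.\<close>

lemma hyp_rec:
  assumes "s + u < N"
  shows "hyp s u = hyp (Suc s) u + hyp s (Suc u)"
proof -
  define A where "A = ffall r s * ffall (real N - r) u"
  define B where "B = ffall (real N) (s + u)"
  define C where "C = real N - real (s + u)"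
  have "B > 0" "C > 0"
    using assms by (auto simp: B_def C_def intro!: ffall_pos)
  have "hyp (Suc s) u + hyp s (Suc u) = A * (r - real s) / (B * C) + A * (real N - r - real u) / (B * C)"
    by (simp add: hyp_def A_def B_def C_def mult_ac)
  also have "\<dots> = A * C / (B * C)"
    by (simp add: C_def add_divide_distrib [symmetric] algebra_simps)
  also have "\<dots> = A / B"
    using \<open>C > 0\<close> by simp
  finally show ?thesis
    by (simp add: hyp_def A_def B_def)
qed

text \<open>Given \<open>s\<close> ones, the other \<open>N - s\<close> bits carry
  \<open>r - s\<close> ones on average: the moment form of "exactly \<open>r\<close> bits are
  one".\<close>

lemma hyp_Suc_0: "s < N \<Longrightarrow> (real N - real s) * hyp (Suc s) 0 = (r - real s) * hyp s 0"
  by (simp add: hyp_def)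

text \<open>All positivity comes from here. Past these ranges a falling factorial of a half-integer
  picks up negative factors, which is what limits the degree.\<close>

lemma hyp_nonneg:
  assumes "real s \<le> r + 1" "real u \<le> real N - r + 1" "s + u \<le> N"
  shows "hyp s u \<ge> 0"
  unfolding hyp_def using assms
  by (intro divide_nonneg_nonneg mult_nonneg_nonneg ffall_nonneg) auto

text \<open>Total probability: \<open>m - card I\<close> bits are one, \<open>j\<close> bits are
  zero, the bits of \<open>I\<close> are free, and \<open>U\<close> collects those among them that
  are zero.\<close>

lemma sum_hyp_Pow:
  assumes "finite I" "card I \<le> m" "m + j \<le> N"
  shows "(\<Sum>U\<in>Pow I. hyp (m - card U) (j + card U)) = hyp (m - card I) j"
  using assms
proof (induction I arbitrary: m j rule: finite_induct)
  case empty
  then show ?case by simp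
next
  case (insert a I)
  have fin: "finite U" "a \<notin> U" if "U \<in> Pow I" for U
    using that insert.hyps finite_subset by auto
  have inj: "inj_on (insert a) (Pow I)"
    using insert.hyps by (auto simp: inj_on_def)
  have "(\<Sum>U\<in>Pow (insert a I). hyp (m - card U) (j + card U))
      = (\<Sum>U\<in>Pow I. hyp (m - card U) (j + card U))
        + (\<Sum>U\<in>insert a ` Pow I. hyp (m - card U) (j + card U))"
    unfolding Pow_insert using insert.hyps by (intro sum.union_disjoint) auto
  also have "(\<Sum>U\<in>insert a ` Pow I. hyp (m - card U) (j + card U))
      = (\<Sum>U\<in>Pow I. hyp (m - 1 - card U) (Suc j + card U))"
    unfolding sum.reindex[OF inj] o_def by (rule sum.cong) (auto simp: fin)
  also have "\<dots> = hyp (m - 1 - card I) (Suc j)"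
    using insert by (intro insert.IH) auto
  also have "(\<Sum>U\<in>Pow I. hyp (m - card U) (j + card U)) = hyp (m - card I) j"
    using insert by (intro insert.IH) auto
  also have "hyp (m - card I) j + hyp (m - 1 - card I) (Suc j) = hyp (m - card (insert a I)) j"
    using insert hyp_rec[of "m - Suc (card I)" j] by (simp add: Suc_diff_Suc)
  finally show ?case .
qed

text \<open>A signed expectation over assignments \<open>T\<close>, given as the set of bits equal
  to one. For half-integer \<open>r\<close> the masses can take both signs, so positivity on squares
  is a theorem about low degree only.\<close>

definition L :: "(nat set \<Rightarrow> real) \<Rightarrow> real" where
  "L f = (\<Sum>T\<in>Pow {..<N}. hyp (card T) (N - card T) * f T)"

lemma L_add: "L (\<lambda>T. f T + g T) = L f + L g"
  by (simp add: L_def distrib_left sum.distrib)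

lemma L_scale: "L (\<lambda>T. c * f T) = c * L f"
  by (simp add: L_def sum_distrib_left mult_ac)

lemma L_sum: "L (\<lambda>T. \<Sum>a\<in>A. f a T) = (\<Sum>a\<in>A. L (f a))"
  unfolding L_def sum_distrib_left by (rule sum.swap)

lemma L_cong: "(\<And>T. T \<subseteq> {..<N} \<Longrightarrow> f T = g T) \<Longrightarrow> L f = L g"
  by (simp add: L_def)

lemma L_ind:
  assumes S: "S \<subseteq> {..<N}"
  shows "L (ind S) = hyp (card S) 0"
proof -
  have fin: "finite S" and cS: "card S \<le> N"
    using S finite_subset card_mono[OF _ S] by auto
  have "L (ind S) = (\<Sum>T | T \<subseteq> {..<N} \<and> S \<subseteq> T. hyp (card T) (N - card T))"
    unfolding L_def ind_def by (rule sum.mono_neutral_cong_right) auto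
  \<comment> \<open>Indexed by the set \<open>U\<close> of zeros, this is \<open>sum_hyp_Pow\<close>
    with every bit outside \<open>S\<close> free.\<close>
  also have "\<dots> = (\<Sum>U\<in>Pow ({..<N} - S). hyp (N - card U) (0 + card U))"
  proof (rule sum.reindex_bij_witness[of _ "\<lambda>U. {..<N} - U" "\<lambda>T. {..<N} - T"])
    fix T assume "T \<in> {T. T \<subseteq> {..<N} \<and> S \<subseteq> T}"
    then have "card ({..<N} - T) = N - card T" "card T \<le> N"
      using card_mono[of "{..<N}" T] by (auto simp: card_Diff_subset finite_subset)
    then show "hyp (N - card ({..<N} - T)) (0 + card ({..<N} - T)) = hyp (card T) (N - card T)"
      by simp
  qed (use S in auto)
  also have "\<dots> = hyp (N - card ({..<N} - S)) 0"
    by (rule sum_hyp_Pow) (use card_mono[of "{..<N}" "{..<N} - S"] in auto)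
  also have "N - card ({..<N} - S) = card S"
    using S fin cS by (simp add: card_Diff_subset)
  finally show ?thesis .
qed

text \<open>\<open>ind S\<close> is the multilinear monomial of the bits in \<open>S\<close>, so
  these are the functions of multilinear degree at most \<open>k\<close>. The inductive form reduces
  linear claims about \<open>L\<close> to monomials.\<close>

inductive deg_le :: "nat \<Rightarrow> (nat set \<Rightarrow> real) \<Rightarrow> bool" for k where
  deg_le_ind: "S \<subseteq> {..<N} \<Longrightarrow> card S \<le> k \<Longrightarrow> deg_le k (ind S)"
| deg_le_add: "deg_le k f \<Longrightarrow> deg_le k g \<Longrightarrow> deg_le k (\<lambda>T. f T + g T)"
| deg_le_scale: "deg_le k f \<Longrightarrow> deg_le k (\<lambda>T. c * f T)"

lemma deg_le_mono: "deg_le k f \<Longrightarrow> k \<le> l \<Longrightarrow> deg_le l f"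
  by (induction rule: deg_le.induct) (auto intro: deg_le.intros)

lemma deg_le_const: "deg_le k (\<lambda>T. c)"
  using deg_le_scale[OF deg_le_ind[of "{}" k], of c] by (simp add: ind_def)

lemma deg_le_sum: "(\<And>a. a \<in> A \<Longrightarrow> deg_le k (f a)) \<Longrightarrow> deg_le k (\<lambda>T. \<Sum>a\<in>A. f a T)"
proof (induction A rule: infinite_finite_induct)
  case (insert a A)
  then show ?case by (simp add: deg_le_add)
qed (auto intro: deg_le_const)

lemma deg_le_mult:
  assumes "deg_le k f" "deg_le l g"
  shows "deg_le (k + l) (\<lambda>T. f T * g T)"
  using assms(1)
proof induction
  case (deg_le_ind S)
  from assms(2) show ?case
  proof induction
    case (deg_le_ind S')
    have "card (S \<union> S') \<le> k + l"
      using card_Un_le[of S S'] deg_le_ind \<open>card S \<le> k\<close> by linarith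
    then show ?case
      using deg_le.deg_le_ind[of "S \<union> S'" "k + l"] deg_le_ind \<open>S \<subseteq> _\<close> by (simp add: ind_mult)
  next
    case (deg_le_add f g)
    then show ?case by (simp add: distrib_left deg_le.deg_le_add)
  next
    case (deg_le_scale f c)
    then show ?case by (simp add: mult.left_commute deg_le.deg_le_scale)
  qed
next
  case (deg_le_add f g)
  then show ?case by (simp add: distrib_right deg_le.deg_le_add)
next
  case (deg_le_scale f c)
  then show ?case by (simp add: mult.assoc deg_le.deg_le_scale)
qed

lemma deg_le_power: "deg_le k f \<Longrightarrow> deg_le (k * m) (\<lambda>T. f T ^ m)"
proof (induction m)
  case (Suc m)
  then show ?case using deg_le_mult[of k f "k * m"] by simp
qed (auto intro: deg_le_const)

definition excess :: "nat set \<Rightarrow> real" where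
  "excess T = (\<Sum>i<N. ind {i} T) - r"

text \<open>The bits of \<open>S\<close> contribute \<open>card S\<close> ones and the remaining
  bits \<open>r - card S\<close> on average, by \<open>hyp_Suc_0\<close>.\<close>

lemma L_ind_excess:
  assumes S: "S \<subseteq> {..<N}" "card S < N"
  shows "L (\<lambda>T. ind S T * excess T) = 0"
proof -
  have fin: "finite S" using S finite_subset by auto
  have "L (\<lambda>T. ind S T * excess T) = L (\<lambda>T. (\<Sum>i<N. ind (insert i S) T) + (- r) * ind S T)"
    by (rule L_cong) (simp add: excess_def right_diff_distrib sum_distrib_left ind_mult)
  also have "\<dots> = (\<Sum>i<N. hyp (card (insert i S)) 0) - r * hyp (card S) 0"
    using S by (subst L_add, subst L_sum, subst L_scale) (simp add: L_ind)
  also have "(\<Sum>i<N. hyp (card (insert i S)) 0) = (\<Sum>i\<in>S. hyp (card (insert i S)) 0) + (\<Sum>i\<in>{..<N} - S. hyp (card (insert i S)) 0)"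
    using S by (subst sum.subset_diff[OF S(1)]) auto
  also have "(\<Sum>i\<in>S. hyp (card (insert i S)) 0) = real (card S) * hyp (card S) 0"
    by (simp add: insert_absorb)
  also have "(\<Sum>i\<in>{..<N} - S. hyp (card (insert i S)) 0) = (real N - real (card S)) * hyp (Suc (card S)) 0"
    using fin S by (simp add: card_Diff_subset of_nat_diff)
  finally show ?thesis
    using hyp_Suc_0[OF S(2)] by (simp add: algebra_simps)
qed

lemma L_mult_excess: "deg_le k f \<Longrightarrow> k < N \<Longrightarrow> L (\<lambda>T. f T * excess T) = 0"
proof (induction rule: deg_le.induct)
  case (deg_le_add f g)
  then show ?case by (simp add: distrib_right L_add)
next
  case (deg_le_scale f c)
  then show ?case by (simp add: mult.assoc L_scale)
qed (simp add: L_ind_excess)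

section \<open>Reduction to homogeneous polynomials\<close>

definition slices :: "nat \<Rightarrow> nat set set" where
  "slices d = {S. S \<subseteq> {..<N} \<and> card S = d}"

text \<open>Equality up to what \<open>L\<close> cannot detect when pairing with degree
  \<open>d\<close>. This suffices for squares: if \<open>q\<close> is the homogeneous form of
  \<open>f\<close>, then \<open>L (f * f) = L (f * q) = L (q * q)\<close>, each step pairing with a
  function of degree \<open>d\<close>.\<close>

definition homog :: "nat \<Rightarrow> (nat set \<Rightarrow> real) \<Rightarrow> bool" where
  "homog d f \<longleftrightarrow> (\<exists>a. \<forall>g. deg_le d g \<longrightarrow>
     L (\<lambda>T. f T * g T) = L (\<lambda>T. (\<Sum>S\<in>slices d. a S * ind S T) * g T))"

lemma finite_slices: "finite (slices d)"
  unfolding slices_def by (rule finite_subset[of _ "Pow {..<N}"]) auto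

lemma homog_add:
  assumes "homog d f" "homog d g"
  shows "homog d (\<lambda>T. f T + g T)"
proof -
  obtain a where
    "\<forall>h. deg_le d h \<longrightarrow> L (\<lambda>T. f T * h T) = L (\<lambda>T. (\<Sum>S\<in>slices d. a S * ind S T) * h T)"
    using assms(1) unfolding homog_def by (elim exE)
  moreover obtain b where
    "\<forall>h. deg_le d h \<longrightarrow> L (\<lambda>T. g T * h T) = L (\<lambda>T. (\<Sum>S\<in>slices d. b S * ind S T) * h T)"
    using assms(2) unfolding homog_def by (elim exE)
  ultimately show ?thesis
    unfolding homog_def
    by (intro exI[of _ "\<lambda>S. a S + b S"]) (simp add: distrib_right sum.distrib L_add)
qed

lemma homog_scale:
  assumes "homog d f"
  shows "homog d (\<lambda>T. c * f T)"
proof -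
  obtain a where
    "\<forall>h. deg_le d h \<longrightarrow> L (\<lambda>T. f T * h T) = L (\<lambda>T. (\<Sum>S\<in>slices d. a S * ind S T) * h T)"
    using assms unfolding homog_def by (elim exE)
  then show ?thesis
    unfolding homog_def
    by (intro exI[of _ "\<lambda>S. c * a S"]) (simp add: mult.assoc L_scale flip: sum_distrib_left)
qed

lemma homog_sum: "(\<And>a. a \<in> A \<Longrightarrow> homog d (f a)) \<Longrightarrow> homog d (\<lambda>T. \<Sum>a\<in>A. f a T)"
proof (induction A rule: infinite_finite_induct)
  case (insert a A)
  then show ?case by (simp add: homog_add)
qed (auto simp: homog_def intro!: exI[of _ "\<lambda>_. 0"])

text \<open>Modulo \<open>excess\<close>, the monomial of \<open>S\<close> is \<open>1 / (r - card S)\<close> times the sum of the monomials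
  of the sets \<open>insert i S\<close>.\<close>

lemma homog_ind:
  assumes "2 * d \<le> N" "real d \<le> r" "S \<subseteq> {..<N}" "card S \<le> d"
  shows "homog d (ind S)"
  using assms(3,4)
proof (induction "d - card S" arbitrary: S)
  case 0
  have "(\<Sum>S'\<in>slices d. (if S' = S then 1 else 0) * ind S' T) = ind S T" for T
    using 0 finite_slices by (simp add: slices_def if_distrib[of "\<lambda>x. x * _"] cong: if_cong)
  then show ?case
    unfolding homog_def by (intro exI[of _ "\<lambda>S'. if S' = S then 1 else 0"]) (simp only: simp_thms)
next
  case (Suc k)
  define c where "c = r - real (card S)"
  have "c > 0" using Suc assms by (simp add: c_def)
  have fin: "finite S" using Suc.prems finite_subset by auto
  have "homog d (ind (insert i S))" if "i \<in> {..<N} - S" for i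
    using that Suc fin by (intro Suc.hyps) auto
  then have "homog d (\<lambda>T. 1 / c * (\<Sum>i\<in>{..<N} - S. ind (insert i S) T))"
    by (intro homog_scale homog_sum)
  moreover have "L (\<lambda>T. (1 / c * (\<Sum>i\<in>{..<N} - S. ind (insert i S) T)) * g T) = L (\<lambda>T. ind S T * g T)"
    if g: "deg_le d g" for g
  proof -
    \<comment> \<open>Here \<open>card S < d\<close>, so the product has degree at most
      \<open>card S + d < 2 * d \<le> N\<close>, the range in which \<open>L\<close> kills multiples
      of \<open>excess\<close>.\<close>
    have L0: "L (\<lambda>T. ind S T * g T * excess T) = 0"
      using Suc assms by (intro L_mult_excess[OF deg_le_mult[OF deg_le_ind[of S "card S"] g]]) auto
    have eq: "ind S T * excess T = (\<Sum>i\<in>{..<N} - S. ind (insert i S) T) + (- c) * ind S T" for T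
    proof -
      have "ind S T * (\<Sum>i<N. ind {i} T) = (\<Sum>i<N. ind (insert i S) T)"
        by (simp add: sum_distrib_left ind_mult)
      also have "\<dots> = (\<Sum>i\<in>S. ind (insert i S) T) + (\<Sum>i\<in>{..<N} - S. ind (insert i S) T)"
        using Suc.prems by (subst sum.subset_diff[OF Suc.prems(1)]) auto
      also have "(\<Sum>i\<in>S. ind (insert i S) T) = card S * ind S T"
        by (simp add: insert_absorb)
      finally show ?thesis
        by (simp add: excess_def c_def algebra_simps)
    qed
    have eq2: "ind S T * g T * excess T =
        (\<Sum>i\<in>{..<N} - S. ind (insert i S) T) * g T + (- c) * (ind S T * g T)" for T
    proof -
      have "ind S T * g T * excess T = (ind S T * excess T) * g T"
        by (simp only: mult_ac)
      also have "\<dots> = ((\<Sum>i\<in>{..<N} - S. ind (insert i S) T) + (- c) * ind S T) * g T"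
        by (simp only: eq)
      finally show ?thesis by (simp only: distrib_right mult.assoc)
    qed
    have "L (\<lambda>T. (\<Sum>i\<in>{..<N} - S. ind (insert i S) T) * g T) + (- c) * L (\<lambda>T. ind S T * g T) = 0"
      using L0 by (simp only: eq2 L_add L_scale)
    then have "L (\<lambda>T. (\<Sum>i\<in>{..<N} - S. ind (insert i S) T) * g T) = c * L (\<lambda>T. ind S T * g T)"
      by simp
    moreover have "L (\<lambda>T. (1 / c * (\<Sum>i\<in>{..<N} - S. ind (insert i S) T)) * g T)
        = 1 / c * L (\<lambda>T. (\<Sum>i\<in>{..<N} - S. ind (insert i S) T) * g T)"
      unfolding mult.assoc by (rule L_scale)
    ultimately show ?thesis
      using \<open>c > 0\<close> by simp
  qed
  ultimately show ?case unfolding homog_def by (elim ex_forward) simp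
qed

lemma homog_deg_le:
  assumes "2 * d \<le> N" "real d \<le> r" "deg_le d f"
  shows "homog d f"
  using assms(3)
proof induction
  case (deg_le_ind S)
  then show ?case by (rule homog_ind[OF assms(1,2)])
next
  case (deg_le_add f g)
  then show ?case by (intro homog_add)
next
  case (deg_le_scale f c)
  show ?case by (rule homog_scale[OF deg_le_scale.IH])
qed

text \<open>On homogeneous polynomials the moment matrix is an explicit sum of squares, by
  \<open>sum_hyp_Pow\<close> applied to \<open>I = S \<inter> S'\<close>.\<close>

lemma L_homogeneous_square:
  assumes "2 * d \<le> N"
  shows "L (\<lambda>T. (\<Sum>S\<in>slices d. a S * ind S T) ^ 2)
    = (\<Sum>U\<in>Pow {..<N}. hyp (2 * d - card U) (card U) * (\<Sum>S\<in>slices d. a S * ind U S) ^ 2)"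
proof -
  have mom: "L (ind (S \<union> S')) = (\<Sum>U\<in>Pow {..<N}. hyp (2 * d - card U) (card U) * (ind U S * ind U S'))"
    if "S \<in> slices d" "S' \<in> slices d" for S S'
  proof -
    have fin: "finite S" "finite S'" and sub: "S \<subseteq> {..<N}" "S' \<subseteq> {..<N}"
      and card: "card S = d" "card S' = d"
      using that by (auto simp: slices_def finite_subset)
    have "card (S \<union> S') + card (S \<inter> S') = 2 * d"
      using card_Un_Int[OF fin] card by simp
    then have eq: "card (S \<union> S') = 2 * d - card (S \<inter> S')" and le: "card (S \<inter> S') \<le> 2 * d" by auto
    have "L (ind (S \<union> S')) = hyp (2 * d - card (S \<inter> S')) 0"
      using sub by (simp add: L_ind eq)
    also have "\<dots> = (\<Sum>U\<in>Pow (S \<inter> S'). hyp (2 * d - card U) (0 + card U))"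
      using fin assms le by (intro sum_hyp_Pow[symmetric]) auto
    \<comment> \<open>The range becomes independent of \<open>S\<close> and \<open>S'\<close>, so
      each \<open>U\<close> contributes a rank-one matrix \<open>ind U S * ind U S'\<close>.\<close>
    also have "\<dots> = (\<Sum>U\<in>Pow {..<N}. hyp (2 * d - card U) (card U) * (ind U S * ind U S'))"
      using sub by (intro sum.mono_neutral_cong_left) (auto simp: ind_def)
    finally show ?thesis .
  qed
  have "L (\<lambda>T. (\<Sum>S\<in>slices d. a S * ind S T) ^ 2)
      = L (\<lambda>T. \<Sum>S\<in>slices d. \<Sum>S'\<in>slices d. (a S * a S') * ind (S \<union> S') T)"
    by (simp add: power2_eq_square sum_product flip: ind_mult) (simp add: mult_ac)
  also have "\<dots> = (\<Sum>S\<in>slices d. \<Sum>S'\<in>slices d. (a S * a S') * L (ind (S \<union> S')))"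
    by (simp add: L_sum L_scale)
  also have "\<dots> = (\<Sum>S\<in>slices d. \<Sum>S'\<in>slices d. \<Sum>U\<in>Pow {..<N}.
      hyp (2 * d - card U) (card U) * ((a S * ind U S) * (a S' * ind U S')))"
    by (intro sum.cong refl) (simp add: mom sum_distrib_left mult_ac)
  also have "\<dots> = (\<Sum>S\<in>slices d. \<Sum>U\<in>Pow {..<N}. \<Sum>S'\<in>slices d.
      hyp (2 * d - card U) (card U) * ((a S * ind U S) * (a S' * ind U S')))"
    by (intro sum.cong refl sum.swap)
  also have "\<dots> = (\<Sum>U\<in>Pow {..<N}. \<Sum>S\<in>slices d. \<Sum>S'\<in>slices d.
      hyp (2 * d - card U) (card U) * ((a S * ind U S) * (a S' * ind U S')))"
    by (rule sum.swap)
  also have "\<dots> = (\<Sum>U\<in>Pow {..<N}. hyp (2 * d - card U) (card U) * (\<Sum>S\<in>slices d. a S * ind U S) ^ 2)"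
    unfolding power2_eq_square sum_product by (simp only: sum_distrib_left)
  finally show ?thesis .
qed

lemma L_square_nonneg:
  assumes d: "2 * real d \<le> r" "real d \<le> real N - r" and f: "deg_le d f"
  shows "L (\<lambda>T. f T ^ 2) \<ge> 0"
proof -
  have N: "2 * d \<le> N" and dr: "real d \<le> r" using d by linarith+
  obtain a where a: "\<And>g. deg_le d g \<Longrightarrow> L (\<lambda>T. f T * g T) = L (\<lambda>T. (\<Sum>S\<in>slices d. a S * ind S T) * g T)"
    using homog_deg_le[OF N dr f] unfolding homog_def by auto
  define q where "q T = (\<Sum>S\<in>slices d. a S * ind S T)" for T
  have q: "deg_le d q"
    unfolding q_def by (intro deg_le_sum deg_le_scale deg_le_ind) (auto simp: slices_def)
  have "L (\<lambda>T. f T ^ 2) = L (\<lambda>T. f T * q T)"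
    using a[OF f] by (simp add: power2_eq_square q_def mult.commute)
  also have "\<dots> = L (\<lambda>T. q T ^ 2)"
    using a[OF q] by (simp add: power2_eq_square q_def)
  also have "\<dots> \<ge> 0"
    unfolding q_def L_homogeneous_square[OF N]
  proof (intro sum_nonneg)
    fix U assume U: "U \<in> Pow {..<N}"
    show "hyp (2 * d - card U) (card U) * (\<Sum>S\<in>slices d. a S * ind U S) ^ 2 \<ge> 0"
    \<comment> \<open>A set \<open>U\<close> with more than \<open>d\<close> elements lies in no
      \<open>S\<close> of size \<open>d\<close>, so only coefficients with
      \<open>card U \<le> d\<close> need a sign; the two bounds on \<open>d\<close> put these within
      reach of \<open>hyp_nonneg\<close>.\<close>
    proof (cases "card U \<le> d")
      case True
      then show ?thesis
        using d N by (intro mult_nonneg_nonneg hyp_nonneg) auto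
    next
      case False
      have "ind U S = 0" if "S \<in> slices d" for S
        using that False card_mono[of S U] by (auto simp: slices_def ind_def finite_subset)
      then show ?thesis by simp
    qed
  qed
  finally show ?thesis .
qed

lemma L_1: "L (\<lambda>T. 1) = 1"
proof -
  have "ind {} = (\<lambda>T. 1)" by (simp add: fun_eq_iff ind_def)
  then show ?thesis using L_ind[of "{}"] by (simp add: hyp_def)
qed

end

subsection \<open>Approximate equilibria\<close>

lemma sum_lessThan_double: "(\<Sum>k<2 * N. f k) = (\<Sum>i<N. f (2 * i) + f (2 * i + 1))"
  for f :: "nat \<Rightarrow> 'a::comm_monoid_add"
  by (induction N) (simp_all add: add.assoc)

lemma sum_lessThan_split: "m \<le> n \<Longrightarrow> (\<Sum>k<n. f k) = (\<Sum>k<m. f k) + (\<Sum>k=m..<n. f k)"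
  for f :: "nat \<Rightarrow> 'a::comm_monoid_add"
  using sum.atLeastLessThan_concat[of 0 m n f] by (simp add: atLeast0LessThan)

text \<open>Strategy \<open>2 * i + b < 2 * N\<close> (with \<open>b \<in> {0, 1}\<close>) stands for the literal: bit \<open>i\<close> equals \<open>b\<close>.
  Among the others, even rows bet on more than \<open>r\<close> ones and odd rows on fewer.\<close>

definition row_payoff :: "nat \<Rightarrow> real \<Rightarrow> (nat \<Rightarrow> real) \<Rightarrow> nat \<Rightarrow> nat \<Rightarrow> real" where
  "row_payoff N r w i j =
     (if i < 2 * N then if j < 2 * N then of_bool (i = j) else -1
      else if j < 2 * N then 1 / real N + (if even i then 1 else -1) / 2 * (of_bool (odd j) - r / real N)
      else if i = j then w i else 0)"

definition col_payoff :: "nat \<Rightarrow> (nat \<Rightarrow> real) \<Rightarrow> nat \<Rightarrow> nat \<Rightarrow> real" where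
  "col_payoff N w i j =
     (if i < 2 * N then if j < 2 * N then - of_bool (i div 2 = j div 2) else - 1 / real N
      else if j < 2 * N then -1 else 1 - (if i = j then w i else 0))"

text \<open>Outside \<open>A\<close> no strategy earns more than the best pure payoff
  \<open>m\<close>, so the part inside \<open>A\<close> falls short of \<open>m\<close> by at most
  \<epsilon> in total. Left unnormalised because the mass of \<open>A\<close> may be zero.\<close>

lemma part_regret:
  fixes x R :: "'a \<Rightarrow> real"
  assumes I: "finite I" "A \<subseteq> I" "j \<in> I"
    and x: "\<And>i. i \<in> I \<Longrightarrow> x i \<ge> 0" "sum x I = 1"
    and regret: "\<And>i. i \<in> I \<Longrightarrow> R i - \<epsilon> \<le> (\<Sum>i\<in>I. x i * R i)"
  shows "sum x A * R j \<le> (\<Sum>i\<in>A. x i * R i) + \<epsilon>"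
proof -
  define m where "m = Max (R ` I)"
  have m: "R i \<le> m" if "i \<in> I" for i
    using that I by (simp add: m_def)
  have "m \<in> R ` I"
    unfolding m_def using I by (intro Max_in) auto
  then have "m - \<epsilon> \<le> (\<Sum>i\<in>I. x i * R i)"
    using regret by auto
  also have "\<dots> = (\<Sum>i\<in>A. x i * R i) + (\<Sum>i\<in>I - A. x i * R i)"
    using sum.subset_diff[OF I(2,1), of "\<lambda>i. x i * R i"] by simp
  also have "(\<Sum>i\<in>I - A. x i * R i) \<le> (\<Sum>i\<in>I - A. x i * m)"
    using x m by (intro sum_mono mult_left_mono) auto
  also have "\<dots> = (1 - sum x A) * m"
    using sum.subset_diff[OF I(2,1), of x] x(2) by (simp flip: sum_distrib_right)
  finally have "sum x A * m \<le> (\<Sum>i\<in>A. x i * R i) + \<epsilon>"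
    by (simp add: algebra_simps)
  moreover have "sum x A * R j \<le> sum x A * m"
    using I x m by (intro mult_left_mono sum_nonneg) auto
  ultimately show ?thesis by linarith
qed

section \<open>Regrets within the literal block\<close>

locale approx_equilibrium =
  fixes n N :: nat and r \<epsilon> :: real and w x y :: "nat \<Rightarrow> real"
  assumes N: "0 < N" "2 * N + 2 \<le> n"
    and r: "0 \<le> r" "r \<le> real N"
    and eps: "0 < \<epsilon>" "200 * real N ^ 3 * \<epsilon> \<le> 1"
    and w: "\<And>i. 1 / 2 \<le> w i" "\<And>i. w i \<le> 1"
    and x_nonneg: "\<And>i. i < n \<Longrightarrow> 0 \<le> x i" and x_sum: "(\<Sum>i<n. x i) = 1"
    and y_nonneg: "\<And>i. i < n \<Longrightarrow> 0 \<le> y i" and y_sum: "(\<Sum>i<n. y i) = 1"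
    and row_regret: "\<And>k. k < n \<Longrightarrow> (\<Sum>j<n. row_payoff N r w k j * y j) - \<epsilon>
          \<le> (\<Sum>i<n. x i * (\<Sum>j<n. row_payoff N r w i j * y j))"
    and col_regret: "\<And>k. k < n \<Longrightarrow> (\<Sum>i<n. x i * col_payoff N w i k) - \<epsilon>
          \<le> (\<Sum>j<n. y j * (\<Sum>i<n. x i * col_payoff N w i j))"
begin

abbreviation "D \<equiv> {2 * N..<n}"

text \<open>\<open>S\<close> and \<open>B\<close> are the probabilities that the players choose the
  same literal and the same bit. Inside the block the row player earns \<open>S\<close> and the
  column player pays \<open>B\<close>; \<open>B - S\<close> is the probability of opposite literals
  of one bit.\<close>

definition \<alpha> :: real where "\<alpha> = (\<Sum>i<2 * N. x i)"
definition \<beta> :: real where "\<beta> = (\<Sum>i<2 * N. y i)"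
definition Y1 :: real where "Y1 = (\<Sum>i<N. y (2 * i + 1))"
definition S :: real where "S = (\<Sum>i<2 * N. x i * y i)"
definition B :: real where
  "B = (\<Sum>i<N. (x (2 * i) + x (2 * i + 1)) * (y (2 * i) + y (2 * i + 1)))"
definition R :: "nat \<Rightarrow> real" where "R i = (\<Sum>j<n. row_payoff N r w i j * y j)"
definition C :: "nat \<Rightarrow> real" where "C j = (\<Sum>i<n. x i * col_payoff N w i j)"

lemma sum_n: "(\<Sum>i<n. f i) = (\<Sum>i<2 * N. f i) + (\<Sum>i\<in>D. f i)" for f :: "nat \<Rightarrow> real"
  using N by (intro sum_lessThan_split) auto

lemma xD: "(\<Sum>i\<in>D. x i) = 1 - \<alpha>" and yD: "(\<Sum>i\<in>D. y i) = 1 - \<beta>"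
  using sum_n[of x] sum_n[of y] x_sum y_sum by (simp_all add: \<alpha>_def \<beta>_def)

lemma \<alpha>01: "0 \<le> \<alpha>" "\<alpha> \<le> 1" and \<beta>01: "0 \<le> \<beta>" "\<beta> \<le> 1"
proof -
  show "0 \<le> \<alpha>" "0 \<le> \<beta>"
    unfolding \<alpha>_def \<beta>_def using N by (auto intro!: sum_nonneg x_nonneg y_nonneg)
  have "0 \<le> (\<Sum>i\<in>D. x i)" "0 \<le> (\<Sum>i\<in>D. y i)"
    by (auto intro!: sum_nonneg x_nonneg y_nonneg)
  then show "\<alpha> \<le> 1" "\<beta> \<le> 1" by (simp_all add: xD yD)
qed

lemma \<beta>_eq: "\<beta> = (\<Sum>i<N. y (2 * i)) + Y1"
  by (simp add: \<beta>_def Y1_def sum_lessThan_double sum.distrib)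

lemma R_literal:
  assumes "i < 2 * N"
  shows "R i = y i - (1 - \<beta>)"
proof -
  have "R i = (\<Sum>j<2 * N. if i = j then y j else 0) + (\<Sum>j\<in>D. - y j)"
    unfolding R_def sum_n using assms
    by (intro arg_cong2[where f = "(+)"] sum.cong) (auto simp: row_payoff_def)
  then show ?thesis
    using assms by (simp add: sum_negf yD)
qed

lemma R_D:
  assumes "i \<in> D"
  shows "R i = \<beta> / real N + (if even i then 1 else -1) / 2 * (Y1 - r * \<beta> / real N) + w i * y i"
proof -
  define c where "c = (if even i then 1 else - 1 :: real) / 2"
  have "R i = (\<Sum>j<2 * N. (1 / real N + c * (of_bool (odd j) - r / real N)) * y j)
      + (\<Sum>j\<in>D. if i = j then w i * y i else 0)"
    unfolding R_def sum_n using assms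
    by (intro arg_cong2[where f = "(+)"] sum.cong) (auto simp: row_payoff_def c_def)
  also have "(\<Sum>j<2 * N. (1 / real N + c * (of_bool (odd j) - r / real N)) * y j)
      = (\<Sum>j<2 * N. (1 / real N - c * r / real N) * y j + c * (of_bool (odd j) * y j))"
    by (simp add: algebra_simps)
  also have "\<dots> = (1 / real N - c * r / real N) * \<beta> + c * (\<Sum>j<2 * N. of_bool (odd j) * y j)"
    by (simp only: sum.distrib \<beta>_def sum_distrib_left)
  also have "(\<Sum>j<2 * N. of_bool (odd j) * y j) = Y1"
    by (simp add: sum_lessThan_double Y1_def)
  also have "(\<Sum>j\<in>D. if i = j then w i * y i else 0) = w i * y i"
    using assms by simp
  finally show ?thesis
    unfolding c_def[symmetric] by (simp add: algebra_simps)
qed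

lemma C_literal:
  assumes "i < N" "j = 2 * i \<or> j = 2 * i + 1"
  shows "C j = - (x (2 * i) + x (2 * i + 1)) - (1 - \<alpha>)"
proof -
  have j: "j < 2 * N" "j div 2 = i" using assms by auto
  have "C j = (\<Sum>k<2 * N. - (of_bool (k div 2 = i) * x k)) + (\<Sum>k\<in>D. - x k)"
    unfolding C_def sum_n using j
    by (intro arg_cong2[where f = "(+)"] sum.cong) (auto simp: col_payoff_def)
  also have "(\<Sum>k<2 * N. - (of_bool (k div 2 = i) * x k))
      = (\<Sum>k<N. if k = i then - (x (2 * i) + x (2 * i + 1)) else 0)"
    by (subst sum_lessThan_double, intro sum.cong) auto
  finally show ?thesis
    using assms(1) by (simp add: sum_negf xD)
qed

lemma C_D:
  assumes "j \<in> D"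
  shows "C j = - \<alpha> / real N + (1 - \<alpha>) - w j * x j"
proof -
  have "C j = (\<Sum>k<2 * N. (- 1 / real N) * x k) + (\<Sum>k\<in>D. x k - (if k = j then w j * x j else 0))"
    unfolding C_def sum_n using assms
    by (intro arg_cong2[where f = "(+)"] sum.cong) (auto simp: col_payoff_def algebra_simps)
  also have "(\<Sum>k<2 * N. (- 1 / real N) * x k) = - \<alpha> / real N"
    unfolding sum_distrib_left[symmetric] \<alpha>_def by simp
  finally show ?thesis
    using assms by (simp add: sum_subtractf xD)
qed

lemma row_part: "k < n \<Longrightarrow> \<alpha> * R k \<le> S - \<alpha> * (1 - \<beta>) + \<epsilon>"
proof -
  assume "k < n"
  then have "\<alpha> * R k \<le> (\<Sum>i<2 * N. x i * R i) + \<epsilon>"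
    unfolding \<alpha>_def using row_regret N
    by (intro part_regret[where I = "{..<n}"]) (auto simp: x_nonneg x_sum R_def)
  also have "(\<Sum>i<2 * N. x i * R i) = (\<Sum>i<2 * N. x i * y i - x i * (1 - \<beta>))"
    by (intro sum.cong) (auto simp: R_literal algebra_simps)
  finally show ?thesis by (simp add: sum_subtractf S_def \<alpha>_def sum_distrib_right)
qed

lemma col_part: "k < n \<Longrightarrow> \<beta> * C k \<le> - B - \<beta> * (1 - \<alpha>) + \<epsilon>"
proof -
  assume "k < n"
  then have "\<beta> * C k \<le> (\<Sum>i<2 * N. y i * C i) + \<epsilon>"
    unfolding \<beta>_def using col_regret N
    by (intro part_regret[where I = "{..<n}"]) (auto simp: y_nonneg y_sum C_def)
  also have "(\<Sum>i<2 * N. y i * C i) = (\<Sum>i<N. - ((x (2 * i) + x (2 * i + 1)) * (y (2 * i) + y (2 * i + 1)))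
      - (y (2 * i) + y (2 * i + 1)) * (1 - \<alpha>))"
    by (subst sum_lessThan_double, intro sum.cong) (auto simp: C_literal algebra_simps)
  also have "\<dots> = - B - \<beta> * (1 - \<alpha>)"
    by (simp add: sum_subtractf sum_negf B_def \<beta>_def sum_lessThan_double sum_distrib_right)
  finally show ?thesis .
qed

text \<open>The absolute value is the gain of the better of the two bets, and moving the literal
  mass to that bet must not pay.\<close>

lemma row_excess: "\<alpha> * \<beta> / real N + \<alpha> / 2 * \<bar>Y1 - r * \<beta> / real N\<bar> + \<alpha> * (1 - \<beta>) \<le> S + \<epsilon>"
proof -
  have *: "\<alpha> * (\<beta> / real N + c * (Y1 - r * \<beta> / real N)) \<le> S - \<alpha> * (1 - \<beta>) + \<epsilon>"
    if "c = 1 / 2 \<or> c = -1 / 2" for c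
  proof -
    \<comment> \<open>An even and an odd row outside the block: one bet of each kind.\<close>
    define i where "i = (if c = 1 / 2 then 2 * N else 2 * N + 1)"
    have i: "i \<in> D" "i < n" using N by (auto simp: i_def)
    have "R i = \<beta> / real N + c * (Y1 - r * \<beta> / real N) + w i * y i"
      using that by (subst R_D[OF i(1)]) (auto simp: i_def)
    moreover have "0 \<le> w i * y i"
      using w(1)[of i] y_nonneg[OF i(2)] by simp
    ultimately have "\<alpha> * (\<beta> / real N + c * (Y1 - r * \<beta> / real N)) \<le> \<alpha> * R i"
      using \<alpha>01 by (intro mult_left_mono) auto
    with row_part[OF i(2)] show ?thesis by linarith
  qed
  show ?thesis
    using *[of "1 / 2"] *[of "- 1 / 2"] by (cases "Y1 - r * \<beta> / real N \<ge> 0") (auto simp: algebra_simps abs_if)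
qed

text \<open>A column outside the block loses at most \<open>\<alpha> / N\<close>, its matching
  penalty being at most \<open>1 - \<alpha>\<close>. Hence the bits cannot coincide more often than
  under uniform play, up to \<epsilon>.\<close>

lemma col_D: "B + \<beta> * (1 - \<alpha>) \<le> \<alpha> * \<beta> / real N + \<epsilon>"
proof -
  have D: "2 * N \<in> D" "2 * N < n" using N by auto
  have "w (2 * N) * x (2 * N) \<le> 1 * x (2 * N)"
    using w x_nonneg[OF D(2)] by (intro mult_right_mono) auto
  also have "\<dots> \<le> 1 - \<alpha>"
    unfolding xD[symmetric] using D by (simp, intro member_le_sum) (auto intro: x_nonneg)
  finally have "\<beta> * (- \<alpha> / real N) \<le> \<beta> * C (2 * N)"
    using \<beta>01 by (intro mult_left_mono) (auto simp: C_D[OF D(1)])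
  with col_part[OF D(2)] show ?thesis by (simp add: algebra_simps)
qed

lemma literal_le: "i < 2 * N \<Longrightarrow> \<alpha> * y i \<le> S + \<epsilon>"
  using row_part[of i] N R_literal[of i] by (simp add: algebra_simps)

text \<open>A bit neglected by the row player would be a refuge for the column player, so no bit can
  be neglected.\<close>

lemma block_ge: "i < N \<Longrightarrow> B \<le> \<beta> * (x (2 * i) + x (2 * i + 1)) + \<epsilon>"
proof -
  assume i: "i < N"
  then have C: "C (2 * i) = - (x (2 * i) + x (2 * i + 1)) - (1 - \<alpha>)" by (intro C_literal) auto
  show ?thesis
    using col_part[of "2 * i"] i N unfolding C by (simp add: algebra_simps)
qed

lemma B_minus_S: "B - S = (\<Sum>i<N. x (2 * i) * y (2 * i + 1) + x (2 * i + 1) * y (2 * i))"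
  unfolding B_def S_def sum_lessThan_double sum_subtractf[symmetric]
  by (intro sum.cong) (auto simp: algebra_simps)

lemma S_le_B: "S \<le> B"
proof -
  have "0 \<le> B - S"
    unfolding B_minus_S using N by (intro sum_nonneg add_nonneg_nonneg mult_nonneg_nonneg)
      (auto intro!: x_nonneg y_nonneg)
  then show ?thesis by simp
qed

text \<open>Adding the two regret bounds cancels the common value \<open>\<alpha> * \<beta> / N\<close> of the literal block.\<close>

lemma crossing:
  "\<alpha> / 2 * \<bar>Y1 - r * \<beta> / real N\<bar> + \<alpha> * (1 - \<beta>) + \<beta> * (1 - \<alpha>) + (B - S) \<le> 2 * \<epsilon>"
  using row_excess col_D by linarith

lemma eps_small: "200 * \<epsilon> \<le> 1" "200 * real N * \<epsilon> \<le> 1"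
proof -
  have N1: "1 \<le> real N" using N by simp
  have le: "real N ^ a * \<epsilon> \<le> real N ^ 3 * \<epsilon>" if "a \<le> 3" for a
    using N1 eps that by (intro mult_right_mono power_increasing) auto
  have "200 * (real N ^ a * \<epsilon>) \<le> 1" if "a \<le> 3" for a
    using le[OF that] eps(2) by linarith
  from this[of 0] this[of 1]
  show "200 * \<epsilon> \<le> 1" "200 * real N * \<epsilon> \<le> 1" by auto
qed

section \<open>Equilibria leave the literal block\<close>

text \<open>\<open>crossing\<close> bounds both \<open>\<alpha> * (1 - \<beta>)\<close> and
  \<open>\<beta> * (1 - \<alpha>)\<close> by \<open>2 * \<epsilon>\<close>, so the two masses are
  small together or large together.\<close>

lemma masses: "\<alpha> \<le> 4 * \<epsilon> \<and> \<beta> \<le> 4 * \<epsilon> \<or> 1 / 2 \<le> \<alpha> \<and> 1 / 2 \<le> \<beta>"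
proof -
  have nn: "0 \<le> \<alpha> / 2 * \<bar>Y1 - r * \<beta> / real N\<bar>" "0 \<le> B - S"
    using \<alpha>01 S_le_B by auto
  have a: "0 \<le> \<alpha> * (1 - \<beta>)" "0 \<le> \<beta> * (1 - \<alpha>)"
    using \<alpha>01 \<beta>01 by auto
  have le: "\<alpha> * (1 - \<beta>) \<le> 2 * \<epsilon>" "\<beta> * (1 - \<alpha>) \<le> 2 * \<epsilon>"
    using crossing nn a by linarith+
  have ind1: "\<alpha> \<le> 4 * \<epsilon>" if "\<beta> \<le> 1 / 2"
  proof -
    have "\<alpha> * (1 / 2) \<le> \<alpha> * (1 - \<beta>)" using that \<alpha>01 by (intro mult_left_mono) auto
    with le show ?thesis by linarith
  qed
  have ind2: "\<beta> \<le> 4 * \<epsilon>" if "\<alpha> \<le> 1 / 2"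
  proof -
    have "\<beta> * (1 / 2) \<le> \<beta> * (1 - \<alpha>)" using that \<beta>01 by (intro mult_left_mono) auto
    with le show ?thesis by linarith
  qed
  show ?thesis using ind1 ind2 eps_small(1) by linarith
qed

text \<open>Were the block in serious use, no literal of \<open>y\<close> could much exceed
  \<open>\<beta> / N\<close>, no bit of \<open>x\<close> would be neglected, and \<open>y\<close>
  would follow one assignment with \<open>K\<close> ones, putting \<open>Y1\<close> near
  \<open>K * \<beta> / N\<close>. But \<open>crossing\<close> puts it within
  \<open>8 * \<epsilon>\<close> of \<open>r * \<beta> / N\<close>, and the integer \<open>K\<close>
  is at least 1/2 away from \<open>r\<close>.\<close>

lemma literal_mass_small:
  assumes gap: "\<And>K::nat. 1 / 2 \<le> \<bar>real K - r\<bar>"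
  shows "\<alpha> \<le> 4 * \<epsilon>" "\<beta> \<le> 4 * \<epsilon>"
proof -
  have False if half: "1 / 2 \<le> \<alpha>" "1 / 2 \<le> \<beta>"
  proof -
    have N1: "1 \<le> real N" using N by simp
    have ab: "0 \<le> \<alpha> * (1 - \<beta>)" "0 \<le> \<beta> * (1 - \<alpha>)"
      using \<alpha>01 \<beta>01 by auto
    have nn: "0 \<le> \<alpha> / 2 * \<bar>Y1 - r * \<beta> / real N\<bar>" "0 \<le> B - S"
      using \<alpha>01 S_le_B by auto
    define q where "q = \<alpha> * \<beta> / real N"
    have S: "q - \<epsilon> \<le> S" and B: "B \<le> q + \<epsilon>"
      using row_excess col_D ab nn by (auto simp: q_def)
    have y_le: "y i \<le> \<beta> / real N + 4 * \<epsilon>" if "i < 2 * N" for i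
    proof -
      have "\<alpha> * y i \<le> q + 2 * \<epsilon>"
        using literal_le[OF that] S_le_B B by linarith
      also have "\<dots> \<le> \<alpha> * (\<beta> / real N + 4 * \<epsilon>)"
        using half eps mult_right_mono[of "1/2" \<alpha> "4 * \<epsilon>"] by (simp add: q_def algebra_simps)
      finally show ?thesis using half by simp
    qed
    have block: "1 / (4 * real N) \<le> x (2 * i) + x (2 * i + 1)" if "i < N" for i
    proof -
      have "\<beta> * (\<alpha> / real N) \<le> \<beta> * (x (2 * i) + x (2 * i + 1)) + 2 * \<epsilon>"
        using block_ge[OF that] S S_le_B by (simp add: q_def mult.commute)
      also have "\<dots> \<le> \<beta> * (x (2 * i) + x (2 * i + 1) + 4 * \<epsilon>)"
        using half eps mult_right_mono[of "1/2" \<beta> "4 * \<epsilon>"] by (simp add: algebra_simps)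
      finally have "\<alpha> / real N \<le> x (2 * i) + x (2 * i + 1) + 4 * \<epsilon>"
        by (rule mult_left_le_imp_le) (use half in simp)
      moreover have "1 / 2 / real N \<le> \<alpha> / real N"
        using half by (intro divide_right_mono) auto
      moreover have "4 * \<epsilon> \<le> 1 / (4 * real N)"
        using eps_small(2) N1 eps(1) by (simp add: field_simps)
      ultimately show ?thesis using N1 by (simp add: field_simps)
    qed
    \<comment> \<open>The literal of bit \<open>i\<close> favoured by \<open>x\<close> has
      probability at least \<open>1 / (8 * N)\<close>, so \<open>y\<close> puts at most
      \<open>16 * N * \<epsilon>\<close> on the opposite one.\<close>
    define \<zeta> where "\<zeta> i = (if x (2 * i) \<le> x (2 * i + 1) then 1 else 0 :: nat)" for i
    have lit: "y (2 * i + 1) \<le> real (\<zeta> i) * (\<beta> / real N) + 20 * real N * \<epsilon> \<and>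
               y (2 * i) \<le> (1 - real (\<zeta> i)) * (\<beta> / real N) + 20 * real N * \<epsilon>" if "i < N" for i
    proof -
      have nonneg: "0 \<le> x (2 * i)" "0 \<le> x (2 * i + 1)" "0 \<le> y (2 * i)" "0 \<le> y (2 * i + 1)"
        using that N by (auto intro!: x_nonneg y_nonneg)
      have "x (2 * i) * y (2 * i + 1) + x (2 * i + 1) * y (2 * i) \<le> B - S"
        unfolding B_minus_S using that N
        by (intro member_le_sum) (auto intro!: add_nonneg_nonneg mult_nonneg_nonneg x_nonneg y_nonneg)
      also have "\<dots> \<le> 2 * \<epsilon>" using S B by linarith
      finally have "x (2 * i) * y (2 * i + 1) + x (2 * i + 1) * y (2 * i) \<le> 2 * \<epsilon>" .
      moreover have "0 \<le> x (2 * i) * y (2 * i + 1)" "0 \<le> x (2 * i + 1) * y (2 * i)"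
        using nonneg by auto
      ultimately have cross: "x (2 * i) * y (2 * i + 1) \<le> 2 * \<epsilon>" "x (2 * i + 1) * y (2 * i) \<le> 2 * \<epsilon>"
        by linarith+
      have small: "v \<le> 16 * real N * \<epsilon>" if "u * v \<le> 2 * \<epsilon>" "1 / (8 * real N) \<le> u" "0 \<le> v" for u v
      proof -
        have "1 / (8 * real N) * v \<le> 2 * \<epsilon>"
          using that mult_right_mono[of "1 / (8 * real N)" u v] by linarith
        then show ?thesis using N1 by (simp add: field_simps)
      qed
      have half_block: "1 / (8 * real N) + 1 / (8 * real N) = 1 / (4 * real N)"
        using N1 by (simp add: field_simps)
      have e: "\<epsilon> \<le> real N * \<epsilon>" "0 \<le> real N * \<epsilon>" using N1 eps by simp_all
      show ?thesis
      proof (cases "x (2 * i) \<le> x (2 * i + 1)")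
        case True
        then have "1 / (8 * real N) \<le> x (2 * i + 1)"
          using block[OF that] half_block by linarith
        then have "y (2 * i) \<le> 16 * real N * \<epsilon>"
          by (rule small[OF cross(2) _ nonneg(3)])
        moreover have "y (2 * i + 1) \<le> \<beta> / real N + 4 * \<epsilon>"
          using that by (intro y_le) auto
        ultimately have "y (2 * i) \<le> 20 * real N * \<epsilon>" "y (2 * i + 1) \<le> \<beta> / real N + 20 * real N * \<epsilon>"
          using e by linarith+
        then show ?thesis using True by (simp add: \<zeta>_def)
      next
        case False
        then have "1 / (8 * real N) \<le> x (2 * i)"
          using block[OF that] half_block by linarith
        then have "y (2 * i + 1) \<le> 16 * real N * \<epsilon>"
          by (rule small[OF cross(1) _ nonneg(4)])
        moreover have "y (2 * i) \<le> \<beta> / real N + 4 * \<epsilon>"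
          using that by (intro y_le) auto
        ultimately have "y (2 * i + 1) \<le> 20 * real N * \<epsilon>" "y (2 * i) \<le> \<beta> / real N + 20 * real N * \<epsilon>"
          using e by linarith+
        then show ?thesis using False by (simp add: \<zeta>_def)
      qed
    qed
    define K where "K = (\<Sum>i<N. \<zeta> i)"
    define \<gamma> where "\<gamma> = \<beta> / real N"
    define E where "E = 20 * real N ^ 2 * \<epsilon>"
    have "Y1 \<le> (\<Sum>i<N. real (\<zeta> i) * \<gamma> + 20 * real N * \<epsilon>)"
      unfolding Y1_def \<gamma>_def using lit by (intro sum_mono) auto
    also have "\<dots> = real K * \<gamma> + E"
      by (simp add: sum.distrib K_def E_def sum_distrib_right power2_eq_square)
    finally have up: "Y1 \<le> real K * \<gamma> + E" .
    \<comment> \<open>Bounding the mass on the zero literals from above bounds \<open>Y1\<close>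
      from below.\<close>
    have "\<beta> - Y1 = (\<Sum>i<N. y (2 * i))" by (simp add: \<beta>_eq)
    also have "\<dots> \<le> (\<Sum>i<N. (1 - real (\<zeta> i)) * \<gamma> + 20 * real N * \<epsilon>)"
      unfolding \<gamma>_def using lit by (intro sum_mono) auto
    also have "\<dots> = real N * \<gamma> - real K * \<gamma> + E"
      by (simp add: sum.distrib K_def E_def sum_distrib_right power2_eq_square left_diff_distrib sum_subtractf)
    also have "real N * \<gamma> = \<beta>" using N1 by (simp add: \<gamma>_def)
    finally have lo: "real K * \<gamma> - E \<le> Y1" by linarith
    have "\<bar>Y1 - r * \<gamma>\<bar> \<le> 8 * \<epsilon>"
    proof -
      have "1 / 2 / 2 * \<bar>Y1 - r * \<gamma>\<bar> \<le> \<alpha> / 2 * \<bar>Y1 - r * \<gamma>\<bar>"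
        using half by (intro mult_right_mono) auto
      also have "\<dots> \<le> 2 * \<epsilon>"
        using crossing ab nn by (simp add: \<gamma>_def)
      finally show ?thesis by simp
    qed
    then have "\<bar>real K * \<gamma> - r * \<gamma>\<bar> \<le> E + 8 * \<epsilon>"
      using up lo by linarith
    moreover have "\<bar>real K * \<gamma> - r * \<gamma>\<bar> = \<bar>real K - r\<bar> * \<gamma>"
      unfolding left_diff_distrib[symmetric] abs_mult using \<beta>01 by (simp add: \<gamma>_def)
    moreover have "1 / 2 * (1 / (2 * real N)) \<le> \<bar>real K - r\<bar> * \<gamma>"
      using half N1 by (intro mult_mono gap) (auto simp: \<gamma>_def field_simps)
    ultimately have "1 / 2 * (1 / (2 * real N)) \<le> E + 8 * \<epsilon>" by linarith
    then have "real N * (1 / (4 * real N)) \<le> real N * (E + 8 * \<epsilon>)"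
      using N1 by (intro mult_left_mono) auto
    \<comment> \<open>The right side is at most 28/200 by the bounds on \<epsilon>.\<close>
    then have "1 / 4 \<le> 20 * (real N ^ 3 * \<epsilon>) + 8 * (real N * \<epsilon>)"
      using N1 by (simp add: E_def power2_eq_square power3_eq_cube algebra_simps)
    then show False using eps eps_small by linarith
  qed
  then show "\<alpha> \<le> 4 * \<epsilon>" "\<beta> \<le> 4 * \<epsilon>" using masses by auto
qed

text \<open>\<open>V\<close> is the value of the matching-pennies part. The row player must not gain
  by moving to \<open>s\<close>, nor the column player lose less by moving to \<open>t\<close>, so
  \<open>w s * y s \<le> V \<le> w t * x t\<close> up to multiples of \<epsilon>; the literals
  disturb this only through their small masses.\<close>

lemma D_products:
  assumes gap: "\<And>K::nat. 1 / 2 \<le> \<bar>real K - r\<bar>" and s: "s \<in> D" and t: "t \<in> D"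
  shows "w s * y s \<le> w t * x t + 23 * \<epsilon>"
proof -
  note small = literal_mass_small[OF gap]
  have N1: "1 \<le> real N" using N by simp
  define V where "V = (\<Sum>i\<in>D. w i * x i * y i)"
  have div_N: "0 \<le> u / real N" "u / real N \<le> u" if "0 \<le> u" for u
    using that N1 by (auto simp: divide_le_eq mult_le_cancel_left1)
  have "0 \<le> (\<Sum>i<N. y (2 * i))" "0 \<le> Y1"
    unfolding Y1_def using N by (auto intro!: sum_nonneg y_nonneg)
  then have Y1: "0 \<le> Y1" "Y1 \<le> \<beta>" using \<beta>_eq by auto
  have "0 \<le> r * \<beta> / real N" "r * \<beta> / real N \<le> \<beta>"
    using r \<beta>01 N1 by (auto simp: divide_le_eq mult.commute mult_right_mono)
  then have dev: "\<bar>Y1 - r * \<beta> / real N\<bar> \<le> \<beta>" using Y1 by linarith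
  have R_bounds: "w i * y i - \<beta> \<le> R i" "R i \<le> w i * y i + 2 * \<beta>" if "i \<in> D" for i
  proof -
    define u where "u = Y1 - r * \<beta> / real N"
    define c :: real where "c = (if even i then 1 else -1) / 2"
    have "R i = \<beta> / real N + c * u + w i * y i"
      by (simp only: R_D[OF that] u_def c_def)
    moreover have "\<bar>c * u\<bar> \<le> \<beta>"
      using dev unfolding u_def[symmetric] abs_mult by (simp add: c_def)
    ultimately show "w i * y i - \<beta> \<le> R i" "R i \<le> w i * y i + 2 * \<beta>"
      using div_N[OF \<beta>01(1)] by linarith+
  qed
  have "R s - \<epsilon> \<le> (\<Sum>i<n. x i * R i)"
    using row_regret[of s] s by (simp add: R_def)
  also have "\<dots> = (\<Sum>i<2 * N. x i * y i - x i * (1 - \<beta>)) + (\<Sum>i\<in>D. x i * R i)"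
    unfolding sum_n by (intro arg_cong2[where f = "(+)"] sum.cong) (auto simp: R_literal algebra_simps)
  also have "(\<Sum>i<2 * N. x i * y i - x i * (1 - \<beta>)) = S - \<alpha> * (1 - \<beta>)"
    by (simp add: sum_subtractf S_def \<alpha>_def sum_distrib_right)
  also have "(\<Sum>i\<in>D. x i * R i) \<le> (\<Sum>i\<in>D. w i * x i * y i + 2 * \<beta> * x i)"
  proof (intro sum_mono)
    fix i assume i: "i \<in> D"
    have "x i * R i \<le> x i * (w i * y i + 2 * \<beta>)"
      using R_bounds(2)[OF i] x_nonneg i by (intro mult_left_mono) auto
    then show "x i * R i \<le> w i * x i * y i + 2 * \<beta> * x i" by (simp add: algebra_simps)
  qed
  also have "\<dots> = V + 2 * \<beta> * (1 - \<alpha>)"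
    by (simp add: sum.distrib V_def xD flip: sum_distrib_left)
  finally have "R s - \<epsilon> \<le> S - \<alpha> * (1 - \<beta>) + (V + 2 * \<beta> * (1 - \<alpha>))" by simp
  moreover have "0 \<le> \<alpha> * (1 - \<beta>)" "0 \<le> \<beta> * (1 - \<alpha>)" "0 \<le> \<alpha> * \<beta>"
    using \<alpha>01 \<beta>01 by auto
  moreover have "\<alpha> * \<beta> / real N \<le> \<alpha> * \<beta>"
    using div_N[of "\<alpha> * \<beta>"] \<alpha>01 \<beta>01 by simp
  ultimately have row: "w s * y s \<le> V + 18 * \<epsilon>"
    using R_bounds(1)[OF s] S_le_B col_D small by (simp add: algebra_simps)
  have "C t - \<epsilon> \<le> (\<Sum>i<n. y i * C i)"
    using col_regret[of t] t by (simp add: C_def)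
  also have "\<dots> = (\<Sum>i<2 * N. y i * C i) + (\<Sum>i\<in>D. y i * C i)" by (rule sum_n)
  also have "(\<Sum>i<2 * N. y i * C i) \<le> 0"
  proof (intro sum_nonpos)
    fix j assume j: "j \<in> {..<2 * N}"
    define i where "i = j div 2"
    have i: "i < N" "j = 2 * i \<or> j = 2 * i + 1" using j by (auto simp: i_def)
    have "0 \<le> x (2 * i)" "0 \<le> x (2 * i + 1)" "0 \<le> y j"
      using i j N by (auto intro!: x_nonneg y_nonneg)
    then show "y j * C j \<le> 0"
      unfolding C_literal[OF i] using \<alpha>01 by (intro mult_nonneg_nonpos) auto
  qed
  also have "(\<Sum>i\<in>D. y i * C i) \<le> (\<Sum>i\<in>D. y i * (1 - \<alpha>) - w i * x i * y i)"
  proof (intro sum_mono)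
    fix i assume i: "i \<in> D"
    have "y i * C i \<le> y i * ((1 - \<alpha>) - w i * x i)"
      unfolding C_D[OF i] using div_N(1)[OF \<alpha>01(1)] y_nonneg i by (intro mult_left_mono) auto
    then show "y i * C i \<le> y i * (1 - \<alpha>) - w i * x i * y i" by (simp add: algebra_simps)
  qed
  also have "\<dots> = (1 - \<beta>) * (1 - \<alpha>) - V"
    by (simp add: sum_subtractf V_def yD flip: sum_distrib_right)
  also have "(1 - \<beta>) * (1 - \<alpha>) \<le> 1 - \<alpha>"
    using \<alpha>01 \<beta>01 by (simp add: mult_left_le_one_le)
  finally have "V \<le> w t * x t + \<alpha> / real N + \<epsilon>"
    unfolding C_D[OF t] by simp
  then have "V \<le> w t * x t + 5 * \<epsilon>"
    using div_N[OF \<alpha>01(1)] small by linarith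
  with row show ?thesis by linarith
qed

end

section \<open>Weighted matching pennies\<close>

text \<open>Giving every \<open>s\<close> its minimum \<open>g / w s\<close> uses up
  \<open>g\<close> times the sum of the \<open>1 / w s\<close>; a single \<open>t\<close> can take
  at most the remainder on top. Signs are free so that the lemma also applies to \<open>- y\<close>,
  where it turns an upper bound into a lower one.\<close>

lemma weighted_upper:
  fixes w x :: "'a \<Rightarrow> real"
  assumes D: "finite D" "t \<in> D" and w: "\<And>s. s \<in> D \<Longrightarrow> 0 < w s \<and> w s \<le> 1"
    and lower: "\<And>s. s \<in> D \<Longrightarrow> g \<le> w s * x s"
    and total: "sum x D \<le> c" "g * (\<Sum>s\<in>D. 1 / w s) \<le> c"
  shows "w t * x t \<le> g + (c - g * (\<Sum>s\<in>D. 1 / w s))"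
proof -
  have "(\<Sum>s\<in>D - {t}. g * (1 / w s)) \<le> sum x (D - {t})"
    using w lower by (intro sum_mono) (simp add: divide_le_eq mult.commute)
  moreover have "(\<Sum>s\<in>D - {t}. g * (1 / w s)) = g * (\<Sum>s\<in>D. 1 / w s) - g / w t"
    using D by (simp add: sum_diff1 sum_distrib_left)
  moreover have "sum x (D - {t}) = sum x D - x t"
    using D by (simp add: sum_diff1)
  ultimately have "x t \<le> g / w t + (c - g * (\<Sum>s\<in>D. 1 / w s))"
    using total by linarith
  then have "w t * x t \<le> w t * (g / w t + (c - g * (\<Sum>s\<in>D. 1 / w s)))"
    using w[OF D(2)] by (intro mult_left_mono) auto
  also have "\<dots> = g + w t * (c - g * (\<Sum>s\<in>D. 1 / w s))"
    using w[OF D(2)] by (simp add: distrib_left)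
  also have "w t * (c - g * (\<Sum>s\<in>D. 1 / w s)) \<le> 1 * (c - g * (\<Sum>s\<in>D. 1 / w s))"
    using w[OF D(2)] total by (intro mult_right_mono) auto
  finally show ?thesis by simp
qed

text \<open>Dividing \<open>K(2)\<close> by \<open>w s\<close> and summing over \<open>s\<close>
  bounds \<open>w t * x t\<close> from below by the mass of \<open>y\<close>; dividing by
  \<open>w t\<close> and summing over \<open>t\<close> bounds \<open>w s * y s\<close> from above by
  the mass of \<open>x\<close>. \<open>weighted_upper\<close> supplies the opposite bounds.\<close>

lemma balanced_strategies:
  fixes w x y :: "'a \<Rightarrow> real"
  assumes D: "finite D" "s \<in> D" "t \<in> D" and w: "\<And>s. s \<in> D \<Longrightarrow> 1 / 2 \<le> w s \<and> w s \<le> 1"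
    and x: "sum x D \<le> 1" "1 - \<eta> \<le> sum x D" and y: "sum y D \<le> 1" "1 - \<eta> \<le> sum y D"
    and K: "0 \<le> K" "\<And>s t. s \<in> D \<Longrightarrow> t \<in> D \<Longrightarrow> w s * y s \<le> w t * x t + K"
  shows "w s * x s \<le> w t * x t + (\<eta> + 2 * real (card D) * K)"
    and "w s * y s \<le> w t * y t + (\<eta> + 2 * real (card D) * K)"
proof -
  define l where "l = (\<Sum>s\<in>D. 1 / w s)"
  have wpos: "0 < w s \<and> w s \<le> 1" if "s \<in> D" for s using w[OF that] by auto
  have "0 < l"
    unfolding l_def using D wpos by (intro sum_pos) auto
  have "1 / w s \<le> 2" if "s \<in> D" for s
    using w[OF that] by (simp add: divide_le_eq)
  then have "l \<le> (\<Sum>s\<in>D. 2)"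
    unfolding l_def by (rule sum_mono)
  then have "l * K \<le> 2 * real (card D) * K"
    using K by (intro mult_right_mono) auto
  \<comment> \<open>\<open>1 / l\<close> is the value of exact matching pennies on \<open>D\<close>,
    where both players put \<open>1 / (l * w s)\<close> on \<open>s\<close>.\<close>
  define g where "g = (1 - \<eta>) / l - K"
  define h where "h = 1 / l + K"
  have gl: "g * l = 1 - \<eta> - K * l" and hl: "h * l = 1 + K * l"
    using \<open>0 < l\<close> by (simp_all add: g_def h_def field_simps)
  have eta: "0 \<le> \<eta>" using x by linarith
  have Kl: "0 \<le> K * l" using K \<open>0 < l\<close> by simp
  have x_ge: "g \<le> w t * x t" if "t \<in> D" for t
  proof -
    have "1 - \<eta> \<le> (\<Sum>s\<in>D. (w t * x t + K) * (1 / w s))"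
      using y(2) K(2)[OF _ that] wpos sum_mono[of D y "\<lambda>s. (w t * x t + K) * (1 / w s)"]
      by (force simp: le_divide_eq mult.commute)
    also have "\<dots> = (w t * x t + K) * l"
      by (simp add: l_def sum_distrib_left)
    finally have "(1 - \<eta>) / l \<le> w t * x t + K"
      using \<open>0 < l\<close> by (simp add: divide_le_eq)
    then show ?thesis by (simp add: g_def)
  qed
  have y_le: "w s * y s \<le> h" if "s \<in> D" for s
  proof -
    have "(w s * y s - K) * l = (\<Sum>t\<in>D. (w s * y s - K) * (1 / w t))"
      by (simp add: l_def sum_distrib_left)
    also have "\<dots> \<le> 1"
      using x(1) K(2)[OF that] wpos sum_mono[of D "\<lambda>t. (w s * y s - K) * (1 / w t)" x]
      by (force simp: divide_le_eq mult.commute algebra_simps)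
    finally have "w s * y s - K \<le> 1 / l"
      using \<open>0 < l\<close> by (simp add: le_divide_eq)
    then show ?thesis by (simp add: h_def)
  qed
  have "w s * x s \<le> g + (1 - g * l)"
    unfolding l_def using D wpos x_ge x eta Kl gl by (intro weighted_upper) (auto simp: l_def)
  then show "w s * x s \<le> w t * x t + (\<eta> + 2 * real (card D) * K)"
    using x_ge[OF D(3)] gl \<open>l * K \<le> _\<close> by (simp add: mult.commute)
  have "w t * (- y t) \<le> - h + (- (1 - \<eta>) - (- h) * l)"
    unfolding l_def using D wpos y_le y eta Kl hl
    by (intro weighted_upper) (auto simp: l_def sum_negf)
  then show "w s * y s \<le> w t * y t + (\<eta> + 2 * real (card D) * K)"
    using y_le[OF D(2)] hl \<open>l * K \<le> _\<close> by (simp add: mult.commute)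
qed

text \<open>Measured against \<open>t\<^sub>0\<close>, where the weightings agree,
  \<open>x t\<close> must meet two targets a factor 2 apart, so it is nearly zero, and balance drags
  every other strategy down with it. This contradicts \<open>D_mass\<close> when two games share a
  strategy.\<close>

lemma balanced_weights_unique:
  fixes w w' x :: "'a \<Rightarrow> real"
  assumes D: "finite D" "t\<^sub>0 \<in> D" "t \<in> D" and w: "\<And>s. s \<in> D \<Longrightarrow> 1 / 2 \<le> w s"
    and bal: "\<And>s t. s \<in> D \<Longrightarrow> t \<in> D \<Longrightarrow> w s * x s \<le> w t * x t + \<delta>"
    and bal': "\<And>s t. s \<in> D \<Longrightarrow> t \<in> D \<Longrightarrow> w' s * x s \<le> w' t * x t + \<delta>"
    and ref: "w t\<^sub>0 = w' t\<^sub>0" and diff: "w t = 1 \<and> w' t = 1 / 2 \<or> w t = 1 / 2 \<and> w' t = 1"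
    and x: "\<And>s. s \<in> D \<Longrightarrow> 0 \<le> x s"
  shows "sum x D \<le> 12 * real (card D) * \<delta>"
proof -
  have "w t * x t \<le> w' t * x t + 2 * \<delta>" "w' t * x t \<le> w t * x t + 2 * \<delta>"
    using bal[OF D(2,3)] bal[OF D(3,2)] bal'[OF D(2,3)] bal'[OF D(3,2)] ref by auto
  moreover have "w t * x t - w' t * x t = x t / 2 \<or> w' t * x t - w t * x t = x t / 2"
    using diff by auto
  ultimately have "x t \<le> 4 * \<delta>" by linarith
  moreover have "w t * x t \<le> 1 * x t" using diff x[OF D(3)] by (intro mult_right_mono) auto
  ultimately have "w t * x t \<le> 4 * \<delta>" by linarith
  have "x s \<le> 12 * \<delta>" if "s \<in> D" for s
  proof -
    have "0 \<le> \<delta>" using bal[OF D(2,2)] by simp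
    have "1 / 2 * x s \<le> w s * x s"
      using w x that by (intro mult_right_mono) auto
    with bal[OF that D(3)] \<open>w t * x t \<le> 4 * \<delta>\<close> \<open>0 \<le> \<delta>\<close> show ?thesis by linarith
  qed
  then have "sum x D \<le> (\<Sum>s\<in>D. 12 * \<delta>)" by (rule sum_mono)
  then show ?thesis by simp
qed

context approx_equilibrium
begin

lemma balanced:
  assumes gap: "\<And>K::nat. 1 / 2 \<le> \<bar>real K - r\<bar>" and "s \<in> D" "t \<in> D"
  shows "w s * x s \<le> w t * x t + 50 * real n * \<epsilon>" and "w s * y s \<le> w t * y t + 50 * real n * \<epsilon>"
proof -
  note small = literal_mass_small[OF gap]
  have "1 * \<epsilon> \<le> real n * \<epsilon>" using N eps by (intro mult_right_mono) auto
  moreover have "real (n - 2 * N) * \<epsilon> \<le> real n * \<epsilon>" using eps by (intro mult_right_mono) auto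
  \<comment> \<open>\<open>balanced_strategies\<close> is used with
    \<open>\<eta> = 4 * \<epsilon>\<close> and \<open>K = 23 * \<epsilon>\<close>;
    \<open>4 + 46 * n \<le> 50 * n\<close>.\<close>
  ultimately have le: "4 * \<epsilon> + 2 * real (card D) * (23 * \<epsilon>) \<le> 50 * real n * \<epsilon>"
    by (simp add: mult.assoc)
  have *: "finite D" "\<And>s. s \<in> D \<Longrightarrow> 1 / 2 \<le> w s \<and> w s \<le> 1"
      "sum x D \<le> 1" "1 - 4 * \<epsilon> \<le> sum x D" "sum y D \<le> 1" "1 - 4 * \<epsilon> \<le> sum y D" "0 \<le> 23 * \<epsilon>"
    using w eps small \<alpha>01 \<beta>01 by (auto simp only: xD yD)
  note bs = balanced_strategies[OF *(1) assms(2,3) *(2-7) D_products[OF gap]]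
  from bs le show "w s * x s \<le> w t * x t + 50 * real n * \<epsilon>" "w s * y s \<le> w t * y t + 50 * real n * \<epsilon>"
    by linarith+
qed

lemma D_mass:
  assumes gap: "\<And>K::nat. 1 / 2 \<le> \<bar>real K - r\<bar>"
  shows "1 / 2 < (\<Sum>i\<in>D. x i)" "1 / 2 < (\<Sum>i\<in>D. y i)"
  using literal_mass_small[OF gap] eps_small(1) by (simp_all add: xD yD)

end

subsection \<open>The pseudo-equilibrium\<close>

context knapsack
begin

text \<open>The strategy of both players at assignment \<open>T\<close>: uniform on the
  \<open>N\<close> literals that \<open>T\<close> makes true.\<close>

definition lit :: "nat \<Rightarrow> nat set \<Rightarrow> real" where
  "lit k T = (if k < 2 * N \<and> (odd k \<longleftrightarrow> k div 2 \<in> T) then 1 / real N else 0)"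

definition point :: "nat \<Rightarrow> nat set \<Rightarrow> real vec" where
  "point n T = vec (2 * n) (\<lambda>k. lit (if k < n then k else k - n) T)"

text \<open>The push-forward of the masses of \<open>L\<close> along \<open>point n\<close>; summing
  over fibres avoids an injectivity argument.\<close>

definition pseudo_dist :: "nat \<Rightarrow> real vec \<Rightarrow> real" where
  "pseudo_dist n z = (\<Sum>T | T \<in> Pow {..<N} \<and> point n T = z. hyp (card T) (N - card T))"

lemma point_x: "i < n \<Longrightarrow> point n T $ i = lit i T"
  and point_y: "i < n \<Longrightarrow> point n T $ (n + i) = lit i T"
  by (simp_all add: point_def)

lemma pseudo_dist_support: "{z. pseudo_dist n z \<noteq> 0} \<subseteq> point n ` Pow {..<N}"
proof
  fix z assume z: "z \<in> {z. pseudo_dist n z \<noteq> 0}"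
  show "z \<in> point n ` Pow {..<N}"
  proof (rule ccontr)
    assume "z \<notin> point n ` Pow {..<N}"
    then have empty: "{T. T \<in> Pow {..<N} \<and> point n T = z} = {}" by auto
    have "pseudo_dist n z = 0" unfolding pseudo_dist_def empty by simp
    with z show False by simp
  qed
qed

lemma finite_signed_measure_pseudo_dist: "finite_signed_measure (2 * n) (pseudo_dist n)"
  unfolding finite_signed_measure_def
proof
  show "finite {z. pseudo_dist n z \<noteq> 0}"
    by (rule finite_subset[OF pseudo_dist_support]) auto
  show "{z. pseudo_dist n z \<noteq> 0} \<subseteq> carrier_vec (2 * n)"
    by (rule order.trans[OF pseudo_dist_support]) (auto simp: point_def)
qed

lemma pseudo_expectation_eq_L: "pseudo_expectation (pseudo_dist n) f = L (\<lambda>T. peval f (point n T))"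
proof -
  have "pseudo_expectation (pseudo_dist n) f = (\<Sum>z\<in>point n ` Pow {..<N}. pseudo_dist n z * peval f z)"
    unfolding pseudo_expectation_def using pseudo_dist_support
    by (intro sum.mono_neutral_left) auto
  also have "\<dots> = (\<Sum>z\<in>point n ` Pow {..<N}. \<Sum>T | T \<in> Pow {..<N} \<and> point n T = z.
      hyp (card T) (N - card T) * peval f (point n T))"
    unfolding pseudo_dist_def sum_distrib_right by (intro sum.cong) auto
  also have "\<dots> = L (\<lambda>T. peval f (point n T))"
    unfolding L_def by (intro sum.image_gen[symmetric]) auto
  finally show ?thesis .
qed

lemma lit_deg_le: "deg_le 1 (lit k)"
proof (cases "k < 2 * N")
  case True
  define f where "f = ind {k div 2}"
  have f: "deg_le 1 f" unfolding f_def using True by (intro deg_le_ind) auto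
  show ?thesis
  proof (cases "odd k")
    case odd: True
    have "lit k = (\<lambda>T. 1 / real N * f T)"
      using True odd by (auto simp: lit_def f_def ind_def)
    then show ?thesis using deg_le_scale[OF f, of "1 / real N"] by simp
  next
    case even: False
    have "lit k = (\<lambda>T. 1 / real N + (- 1 / real N) * f T)"
      using True even by (auto simp: lit_def f_def ind_def)
    then show ?thesis
      using deg_le_add[OF deg_le_const deg_le_scale[OF f], of "1 / real N" "- 1 / real N"] by simp
  qed
next
  case False
  then have "lit k = (\<lambda>T. 0)" by (auto simp: lit_def)
  then show ?thesis using deg_le_const[of 1 0] by simp
qed

lemma deg_le_prod: "(\<And>a. a \<in> A \<Longrightarrow> deg_le (m a) (f a)) \<Longrightarrow> deg_le (\<Sum>a\<in>A. m a) (\<lambda>T. \<Prod>a\<in>A. f a T)"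
proof (induction A rule: infinite_finite_induct)
  case (insert a A)
  then show ?case using deg_le_mult[of "m a" "f a" "\<Sum>a\<in>A. m a" "\<lambda>T. \<Prod>a\<in>A. f a T"] by simp
qed (auto intro: deg_le_const)

lemma deg_le_peval:
  assumes "p \<in> rpolys (2 * n)"
  shows "deg_le (total_degree p) (\<lambda>T. peval p (point n T))"
  unfolding peval_def
proof (rule deg_le_sum, rule deg_le_scale)
  fix t assume t: "t \<in> Poly_Mapping.keys p"
  have "deg_le (monomial_degree t) (\<lambda>T. \<Prod>k\<in>Poly_Mapping.keys t. (point n T $ k) ^ Poly_Mapping.lookup t k)"
    unfolding monomial_degree_def
  proof (rule deg_le_prod)
    fix k assume "k \<in> Poly_Mapping.keys t"
    then have "k < 2 * n" using assms t by (auto simp: rpolys_def)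
    then have "point n T $ k = lit (if k < n then k else k - n) T" for T
      by (simp add: point_def)
    then show "deg_le (Poly_Mapping.lookup t k) (\<lambda>T. (point n T $ k) ^ Poly_Mapping.lookup t k)"
      using deg_le_power[OF lit_deg_le[of "if k < n then k else k - n"], of "Poly_Mapping.lookup t k"]
      by (simp only: mult_1)
  qed
  then show "deg_le (total_degree p) (\<lambda>T. \<Prod>k\<in>Poly_Mapping.keys t. (point n T $ k) ^ Poly_Mapping.lookup t k)"
    using total_degree_le_iff[of p "total_degree p"] t by (auto intro: deg_le_mono)
qed

text \<open>With \<open>f\<close> the values of \<open>p\<close>, the product becomes
  \<open>c * (f * v)^2 + c' * f^2 * excess\<close>. The square has degree \<open>Suc d\<close> at
  its root, the extra one coming from \<open>v\<close>; the other term vanishes under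
  \<open>L\<close> because \<open>2 * d < N\<close>.\<close>

lemma satisfies_ge0I:
  assumes d: "2 * real (Suc d) \<le> r" "real (Suc d) \<le> real N - r"
    and c: "0 \<le> c" and v: "deg_le 1 v"
    and h: "\<And>T. T \<subseteq> {..<N} \<Longrightarrow> peval h (point n T) = c * v T ^ 2 + c' * excess T"
  shows "satisfies_ge0 (2 * n) (2 * d) (pseudo_dist n) h"
  unfolding satisfies_ge0_def
proof (intro ballI impI)
  fix p assume p: "p \<in> rpolys (2 * n)" "total_degree (p ^ 2 * h) \<le> 2 * d"
  show "0 \<le> pseudo_expectation (pseudo_dist n) (p ^ 2 * h)"
  proof (cases "h = 0")
    case False
    then have "total_degree p \<le> d"
      using total_degree_square_mult_le[OF p(2)] by simp
    define f where "f T = peval p (point n T)" for T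
    have f: "deg_le d f"
      unfolding f_def using deg_le_peval[OF p(1)] \<open>total_degree p \<le> d\<close> by (rule deg_le_mono)
    have fv: "deg_le (Suc d) (\<lambda>T. f T * v T)"
      using deg_le_mult[OF f v] by simp
    have ff: "deg_le (d + d) (\<lambda>T. f T * f T)"
      by (rule deg_le_mult[OF f f])
    have "real (d + d) < real N" using d by simp
    then have "d + d < N" by simp
    have "pseudo_expectation (pseudo_dist n) (p ^ 2 * h)
        = L (\<lambda>T. c * (f T * v T) ^ 2 + c' * (f T * f T * excess T))"
      unfolding pseudo_expectation_eq_L
      by (rule L_cong) (simp add: h f_def power2_eq_square algebra_simps)
    also have "\<dots> = c * L (\<lambda>T. (f T * v T) ^ 2) + c' * L (\<lambda>T. f T * f T * excess T)"
      by (simp only: L_add L_scale)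
    also have "L (\<lambda>T. f T * f T * excess T) = 0"
      by (rule L_mult_excess[OF ff \<open>d + d < N\<close>])
    finally show ?thesis
      using c L_square_nonneg[OF d fv] by simp
  qed (simp add: pseudo_expectation_def)
qed

lemma satisfies_eq0I:
  assumes d: "2 * real (Suc d) \<le> r" "real (Suc d) \<le> real N - r"
    and h: "\<And>T. T \<subseteq> {..<N} \<Longrightarrow> peval h (point n T) = 0"
  shows "satisfies_eq0 (2 * n) (2 * d) (pseudo_dist n) h"
  unfolding satisfies_eq0_def
  using assms by (auto intro!: satisfies_ge0I[where c = 0 and c' = 0 and v = "\<lambda>T. 0"] deg_le_const)

section \<open>Payoffs on the support of the pseudo-distribution\<close>

lemma sum_lit:
  assumes "2 * N \<le> n"
  shows "(\<Sum>k<n. g k * lit k T) = (\<Sum>i<N. g (2 * i + of_bool (i \<in> T))) / real N"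
proof -
  have "(\<Sum>k<n. g k * lit k T) = (\<Sum>k<2 * N. g k * lit k T)"
    using assms by (intro sum.mono_neutral_right) (auto simp: lit_def)
  also have "\<dots> = (\<Sum>i<N. g (2 * i + of_bool (i \<in> T)) / real N)"
    by (subst sum_lessThan_double, intro sum.cong) (auto simp: lit_def)
  finally show ?thesis by (simp add: sum_divide_distrib)
qed

lemma excess_eq: "excess T = (\<Sum>i<N. of_bool (i \<in> T)) - r"
  unfolding excess_def by (intro arg_cong2[where f = "(-)"] sum.cong) (auto simp: ind_def)

text \<open>Only a bet can beat the common value \<open>1 / N\<close>, and only through
  \<open>excess\<close>, which \<open>L\<close> does not see.\<close>

lemma row_payoff_lit:
  assumes "0 < N" "2 * N \<le> n" "i < n"
  shows "(\<Sum>j<n. row_payoff N r w i j * lit j T)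
    = (if i < 2 * N then lit i T else 1 / real N + (if even i then 1 else -1) / (2 * real N) * excess T)"
proof (cases "i < 2 * N")
  case True
  have "(\<Sum>j<n. row_payoff N r w i j * lit j T) = (\<Sum>j<n. if i = j then lit i T else 0)"
    using True by (intro sum.cong) (auto simp: row_payoff_def lit_def)
  then show ?thesis using True assms by simp
next
  case False
  define c where "c = (if even i then 1 else -1 :: real) / 2"
  have "row_payoff N r w i (2 * k + of_bool (k \<in> T)) = 1 / real N + c * of_bool (k \<in> T) - c * r / real N" if "k < N" for k
    using False that by (auto simp: row_payoff_def c_def algebra_simps diff_divide_distrib)
  then have "(\<Sum>j<n. row_payoff N r w i j * lit j T)
      = (\<Sum>k<N. 1 / real N + c * of_bool (k \<in> T) - c * r / real N) / real N"
    unfolding sum_lit[OF assms(2)] by simp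
  also have "(\<Sum>k<N. 1 / real N + c * of_bool (k \<in> T) - c * r / real N) = 1 + c * excess T"
    using assms(1) unfolding excess_eq sum_subtractf sum.distrib sum_distrib_left[symmetric]
    by (simp add: algebra_simps)
  finally show ?thesis
    using False by (simp add: add_divide_distrib c_def)
qed

text \<open>A literal column meets exactly one true literal of its bit, and any other column costs
  \<open>1 / N\<close> against every literal, so the column player is indifferent.\<close>

lemma col_payoff_lit:
  assumes "0 < N" "2 * N \<le> n"
  shows "(\<Sum>i<n. col_payoff N w i j * lit i T) = - 1 / real N"
proof -
  have "(\<Sum>k<N. col_payoff N w (2 * k + of_bool (k \<in> T)) j) = -1"
  proof (cases "j < 2 * N")
    case True
    then have "(\<Sum>k<N. col_payoff N w (2 * k + of_bool (k \<in> T)) j) = (\<Sum>k<N. if k = j div 2 then - 1 else 0)"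
      by (intro sum.cong) (auto simp: col_payoff_def)
    then show ?thesis using True by simp
  next
    case False
    then have "(\<Sum>k<N. col_payoff N w (2 * k + of_bool (k \<in> T)) j) = (\<Sum>k<N. - 1 / real N)"
      by (intro sum.cong) (auto simp: col_payoff_def)
    then show ?thesis using assms by simp
  qed
  then show ?thesis unfolding sum_lit[OF assms(2)] by simp
qed

lemma row_payoff_bilinear:
  assumes "0 < N" "2 * N \<le> n"
  shows "(\<Sum>i<n. \<Sum>j<n. row_payoff N r w i j * lit i T * lit j T) = 1 / real N"
proof -
  have "(\<Sum>i<n. \<Sum>j<n. row_payoff N r w i j * lit i T * lit j T)
      = (\<Sum>i<n. (\<Sum>j<n. row_payoff N r w i j * lit j T) * lit i T)"
    by (simp add: sum_distrib_left sum_distrib_right mult_ac)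
  also have "\<dots> = (\<Sum>k<N. \<Sum>j<n. row_payoff N r w (2 * k + of_bool (k \<in> T)) j * lit j T) / real N"
    by (rule sum_lit[OF assms(2)])
  also have "(\<Sum>k<N. \<Sum>j<n. row_payoff N r w (2 * k + of_bool (k \<in> T)) j * lit j T) = (\<Sum>k<N. 1 / real N)"
    using assms by (intro sum.cong refl, subst row_payoff_lit) (auto simp: lit_def)
  finally show ?thesis using assms by simp
qed

lemma col_payoff_bilinear:
  assumes "0 < N" "2 * N \<le> n"
  shows "(\<Sum>i<n. \<Sum>j<n. col_payoff N w i j * lit i T * lit j T) = - 1 / real N"
proof -
  have "(\<Sum>i<n. \<Sum>j<n. col_payoff N w i j * lit i T * lit j T)
      = (\<Sum>j<n. (\<Sum>i<n. col_payoff N w i j * lit i T) * lit j T)"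
    by (subst sum.swap) (simp add: sum_distrib_right)
  also have "\<dots> = (\<Sum>k<N. - 1 / real N) / real N"
    unfolding col_payoff_lit[OF assms] by (rule sum_lit[OF assms(2)])
  finally show ?thesis using assms by simp
qed

end

definition knapsack_game :: "nat \<Rightarrow> nat \<Rightarrow> real \<Rightarrow> (nat \<Rightarrow> real) \<Rightarrow> game" where
  "knapsack_game n N r w = (mat n n (\<lambda>(i, j). row_payoff N r w i j), mat n n (\<lambda>(i, j). col_payoff N w i j))"

context knapsack
begin

lemma peval_xvar: "i < n \<Longrightarrow> peval (xvar n i) (point n T) = lit i T"
  and peval_yvar: "i < n \<Longrightarrow> peval (yvar n i) (point n T) = lit i T"
  by (simp_all add: xvar_def yvar_def point_x point_y)

lemma sum_all_lit:
  assumes "0 < N" "2 * N \<le> n"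
  shows "(\<Sum>k<n. lit k T) = 1"
  using sum_lit[OF assms(2), of "\<lambda>_. 1"] assms by simp

lemma pseudo_equilibrium_knapsack_game:
  assumes N: "0 < N" "2 * N \<le> n"
    and d: "2 * real (Suc d) \<le> r" "real (Suc d) \<le> real N - r"
  shows "pseudo_equilibrium n (2 * d) (knapsack_game n N r w) (pseudo_dist n)"
  unfolding pseudo_equilibrium_def
proof (intro conjI allI impI)
  let ?G = "knapsack_game n N r w"
  have bilin: "peval (bilin_poly n (fst ?G)) (point n T) = 1 / real N"
       "peval (bilin_poly n (snd ?G)) (point n T) = - 1 / real N" for T
    using row_payoff_bilinear[OF N, of w T] col_payoff_bilinear[OF N, of w T]
    by (simp_all add: bilin_poly_def peval_xvar peval_yvar knapsack_game_def)
  have row: "peval (row_poly n (fst ?G) i) (point n T) =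
      (if i < 2 * N then lit i T else 1 / real N + (if even i then 1 else -1) / (2 * real N) * excess T)"
    if "i < n" for i T
    using row_payoff_lit[OF N that, of w T] that by (simp add: row_poly_def peval_yvar knapsack_game_def)
  have col: "peval (col_poly n (snd ?G) j) (point n T) = - 1 / real N" if "j < n" for j T
    using col_payoff_lit[OF N, of w j T] that by (simp add: col_poly_def peval_xvar knapsack_game_def)
  \<comment> \<open>\<open>lit\<close> takes only the values 0 and \<open>1 / N\<close>, so it and
    its complement to \<open>1 / N\<close> are \<open>N\<close> times their own squares.\<close>
  have lit_sq: "lit i T = real N * (lit i T)\<^sup>2" "1 / real N - lit i T = real N * (1 / real N + (- 1) * lit i T)\<^sup>2" for i T
    using N by (auto simp: lit_def power2_eq_square)
  have neg_lit: "deg_le 1 (\<lambda>T. 1 / real N + (- 1) * lit i T)" for i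
    by (intro deg_le_add deg_le_const) (rule deg_le_scale[OF lit_deg_le])
  show "pseudo_distribution (2 * n) (2 * d) (pseudo_dist n)"
    unfolding pseudo_distribution_def
  proof (intro conjI ballI impI finite_signed_measure_pseudo_dist)
    show "pseudo_expectation (pseudo_dist n) 1 = 1"
      by (simp add: pseudo_expectation_eq_L L_1)
    fix q assume q: "q \<in> rpolys (2 * n)" "real (total_degree q) \<le> real (2 * d) / 2"
    have "deg_le (Suc d) (\<lambda>T. peval q (point n T))"
      using deg_le_peval[OF q(1)] by (rule deg_le_mono) (use q(2) in simp)
    then show "0 \<le> pseudo_expectation (pseudo_dist n) (q\<^sup>2)"
      using L_square_nonneg[OF d] by (simp add: pseudo_expectation_eq_L)
  qed
  show "satisfies_ge0 (2 * n) (2 * d) (pseudo_dist n) (xvar n i)" if "i < n" for i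
    by (rule satisfies_ge0I[OF d _ lit_deg_le[of i], of "real N" _ _ 0])
      (use that lit_sq in \<open>simp_all add: peval_xvar\<close>)
  show "satisfies_ge0 (2 * n) (2 * d) (pseudo_dist n) (yvar n i)" if "i < n" for i
    by (rule satisfies_ge0I[OF d _ lit_deg_le[of i], of "real N" _ _ 0])
      (use that lit_sq in \<open>simp_all add: peval_yvar\<close>)
  show "satisfies_eq0 (2 * n) (2 * d) (pseudo_dist n) ((\<Sum>i<n. xvar n i) - 1)"
    by (rule satisfies_eq0I[OF d]) (simp add: peval_xvar sum_all_lit[OF N])
  show "satisfies_eq0 (2 * n) (2 * d) (pseudo_dist n) ((\<Sum>i<n. yvar n i) - 1)"
    by (rule satisfies_eq0I[OF d]) (simp add: peval_yvar sum_all_lit[OF N])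
  show "satisfies_ge0 (2 * n) (2 * d) (pseudo_dist n) (bilin_poly n (fst ?G) - row_poly n (fst ?G) i)"
    if i: "i < n" for i
  proof (cases "i < 2 * N")
    case True
    show ?thesis
    proof (rule satisfies_ge0I[OF d _ neg_lit[of i], of "real N" _ _ 0])
      fix T
      show "peval (bilin_poly n (fst ?G) - row_poly n (fst ?G) i) (point n T)
          = real N * (1 / real N + (- 1) * lit i T)\<^sup>2 + 0 * excess T"
        unfolding lit_sq(2)[symmetric] using True by (simp add: bilin row[OF i])
    qed simp
  next
    case False
    \<comment> \<open>The regret of a bet is a pure multiple of \<open>excess\<close>, hence
      \<open>c = 0\<close>.\<close>
    show ?thesis
      by (rule satisfies_ge0I[OF d _ lit_deg_le[of i], of 0 _ _ "- ((if even i then 1 else -1) / (2 * real N))"])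
        (use False in \<open>simp_all add: bilin row[OF i]\<close>)
  qed
  show "satisfies_ge0 (2 * n) (2 * d) (pseudo_dist n) (bilin_poly n (snd ?G) - col_poly n (snd ?G) j)"
    if "j < n" for j
    by (rule satisfies_ge0I[OF d _ lit_deg_le[of j], of 0 _ _ 0])
      (use that in \<open>simp_all add: bilin col\<close>)
qed

end

subsection \<open>The family of games\<close>

text \<open>\<open>N \<ge> 2\<close> keeps the bets in range: \<open>1 / N\<close> and the stake are
  each at most 1/2 in absolute value.\<close>

lemma row_payoff_bounds:
  assumes "2 \<le> N" "0 \<le> r" "r \<le> real N" "0 \<le> w i" "w i \<le> 1"
  shows "row_payoff N r w i j \<in> {-1..1}"
proof -
  define b :: real where "b = of_bool (odd j) - r / real N"
  have "0 \<le> r / real N" "r / real N \<le> 1"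
    using assms by (auto simp: divide_le_eq)
  then have b: "-1 \<le> b" "b \<le> 1" by (auto simp: b_def)
  define a where "a = 1 / real N"
  have "0 \<le> a" "a \<le> 1 / 2"
    using assms(1) by (auto simp: a_def divide_le_eq)
  then show ?thesis
    unfolding row_payoff_def b_def[symmetric] a_def[symmetric] using b assms by (cases "even i") auto
qed

lemma col_payoff_bounds:
  assumes "2 \<le> N" "0 \<le> w i" "w i \<le> 1"
  shows "col_payoff N w i j \<in> {-1..1}"
  using assms by (auto simp: col_payoff_def divide_le_eq intro: order_trans[of "-1" 0])

lemma is_game_knapsack_game: "is_game n (knapsack_game n N r w)"
  by (simp add: is_game_def knapsack_game_def)

lemma payoffs_in_knapsack_game:
  assumes "2 \<le> N" "0 \<le> r" "r \<le> real N" "\<And>i. 0 \<le> w i" "\<And>i. w i \<le> 1"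
  shows "payoffs_in {-1..1} (knapsack_game n N r w)"
proof -
  have sub: "elements_mat (mat n n (\<lambda>(i, j). f i j)) \<subseteq> A" if "\<And>i j. f i j \<in> A"
    for f :: "nat \<Rightarrow> nat \<Rightarrow> real" and A
  proof
    fix a assume "a \<in> elements_mat (mat n n (\<lambda>(i, j). f i j))"
    from elements_matD[OF this] show "a \<in> A" using that by force
  qed
  show ?thesis
    unfolding payoffs_in_def knapsack_game_def fst_conv snd_conv
  proof (rule conjI; rule sub)
    show "row_payoff N r w i j \<in> {-1..1}" for i j
      using assms by (intro row_payoff_bounds)
    show "col_payoff N w i j \<in> {-1..1}" for i j
      using assms by (intro col_payoff_bounds)
  qed
qed

lemma unit_vec_scalar_prod_mult_mat_vec:
  fixes y :: "real vec"
  assumes "i < n"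
  shows "unit_vec n i \<bullet> (mat n n (\<lambda>(i, j). f i j) *\<^sub>v y) = vec n (f i) \<bullet> y"
proof -
  have "mat n n (\<lambda>(i, j). f i j) *\<^sub>v y \<in> carrier_vec n"
    by (simp add: mult_mat_vec_def)
  from scalar_prod_left_unit[OF this assms] show ?thesis
    using assms by simp
qed

lemma approx_equilibrium_of_eps_NE:
  assumes NE: "eps_NE n \<epsilon> (knapsack_game n N r w) x y"
    and "0 < N" "2 * N + 2 \<le> n" "0 \<le> r" "r \<le> real N" "0 < \<epsilon>" "200 * real N ^ 3 * \<epsilon> \<le> 1"
    and "\<And>i. 1 / 2 \<le> w i" "\<And>i. w i \<le> 1"
  shows "approx_equilibrium n N r \<epsilon> w (\<lambda>i. x $ i) (\<lambda>i. y $ i)"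
proof -
  have x: "x \<in> carrier_vec n" "\<And>i. i < n \<Longrightarrow> 0 \<le> x $ i" "(\<Sum>i<n. x $ i) = 1"
    and y: "y \<in> carrier_vec n" "\<And>i. i < n \<Longrightarrow> 0 \<le> y $ i" "(\<Sum>i<n. y $ i) = 1"
    using NE by (auto simp: eps_NE_def mixed_strategies_def)
  have row: "vec n (f i) \<bullet> y = (\<Sum>j<n. f i j * y $ j)" for f :: "nat \<Rightarrow> nat \<Rightarrow> real" and i
    using y(1) by (simp add: scalar_prod_def atLeast0LessThan)
  have bilin: "x \<bullet> (mat n n (\<lambda>(i, j). f i j) *\<^sub>v y) = (\<Sum>i<n. x $ i * (\<Sum>j<n. f i j * y $ j))" for f
    unfolding scalar_prod_def[of x] by (simp add: atLeast0LessThan row)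
  have col: "x \<bullet> (mat n n (\<lambda>(i, j). f i j) *\<^sub>v unit_vec n k) = (\<Sum>i<n. x $ i * f i k)" if "k < n" for f k
    using that unfolding scalar_prod_def[of x] by (simp add: atLeast0LessThan)
  show ?thesis
  proof unfold_locales
    fix k assume k: "k < n"
    show "(\<Sum>j<n. row_payoff N r w k j * y $ j) - \<epsilon> \<le> (\<Sum>i<n. x $ i * (\<Sum>j<n. row_payoff N r w i j * y $ j))"
      using NE k by (simp add: eps_NE_def knapsack_game_def unit_vec_scalar_prod_mult_mat_vec row bilin)
    have "(\<Sum>i<n. x $ i * col_payoff N w i k) - \<epsilon> \<le> (\<Sum>i<n. x $ i * (\<Sum>j<n. col_payoff N w i j * y $ j))"
      using NE k by (simp add: eps_NE_def knapsack_game_def col bilin)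
    also have "\<dots> = (\<Sum>j<n. y $ j * (\<Sum>i<n. x $ i * col_payoff N w i j))"
      unfolding sum_distrib_left by (subst sum.swap) (simp add: mult_ac)
    finally show "(\<Sum>i<n. x $ i * col_payoff N w i k) - \<epsilon> \<le> (\<Sum>j<n. y $ j * (\<Sum>i<n. x $ i * col_payoff N w i j))" .
  qed (use assms x y in auto)
qed

section \<open>Separation of the games\<close>

lemma approx_equilibria_distinct:
  assumes E: "approx_equilibrium n N r \<epsilon> w x y" and E': "approx_equilibrium n N r \<epsilon> w' x' y'"
    and gap: "\<And>K::nat. 1 / 2 \<le> \<bar>real K - r\<bar>" and eps: "1200 * real n ^ 2 * \<epsilon> \<le> 1"
    and ref: "w (2 * N) = w' (2 * N)"
    and t: "t \<in> {2 * N..<n}" "w t = 1 \<and> w' t = 1 / 2 \<or> w t = 1 / 2 \<and> w' t = 1"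
  shows "x \<noteq> x'" "y \<noteq> y'"
proof -
  interpret E: approx_equilibrium n N r \<epsilon> w x y by fact
  interpret E': approx_equilibrium n N r \<epsilon> w' x' y' by fact
  have t0: "2 * N \<in> E.D" using E.N by auto
  \<comment> \<open>\<open>balanced\<close> gives \<open>\<delta> = 50 * n * \<epsilon>\<close>, so
    the mass bound is \<open>600 * n ^ 2 * \<epsilon>\<close>.\<close>
  have "12 * real (card E.D) * (50 * real n * \<epsilon>) \<le> 12 * real n * (50 * real n * \<epsilon>)"
    using E.eps by (intro mult_right_mono mult_left_mono) auto
  also have "\<dots> \<le> 1 / 2" using eps by (simp add: power2_eq_square)
  finally have small: "12 * real (card E.D) * (50 * real n * \<epsilon>) \<le> 1 / 2" .
  show "x \<noteq> x'"
  proof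
    assume "x = x'"
    have "sum x E.D \<le> 12 * real (card E.D) * (50 * real n * \<epsilon>)"
      by (rule balanced_weights_unique[OF _ t0 t(1) E.w(1) E.balanced(1)[OF gap]
            E'.balanced(1)[OF gap, folded \<open>x = x'\<close>] ref t(2)]) (auto intro: E.x_nonneg)
    with E.D_mass(1)[OF gap] small show False by linarith
  qed
  show "y \<noteq> y'"
  proof
    assume "y = y'"
    have "sum y E.D \<le> 12 * real (card E.D) * (50 * real n * \<epsilon>)"
      by (rule balanced_weights_unique[OF _ t0 t(1) E.w(1) E.balanced(2)[OF gap]
            E'.balanced(2)[OF gap, folded \<open>y = y'\<close>] ref t(2)]) (auto intro: E.y_nonneg)
    with E.D_mass(2)[OF gap] small show False by linarith
  qed
qed

text \<open>Scaling all weights by one factor leaves the balanced strategies unchanged, so the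
  weight at \<open>2 * N\<close> is pinned as a reference.\<close>

definition weights :: "nat \<Rightarrow> nat set \<Rightarrow> nat \<Rightarrow> real" where
  "weights N W k = (if k = 2 * N \<or> k \<in> W then 1 else 1 / 2)"

lemma weights_differ:
  assumes "W \<in> Pow {2 * N + 1..<n}" "W' \<in> Pow {2 * N + 1..<n}" "W \<noteq> W'"
  obtains t where "t \<in> {2 * N..<n}"
    "weights N W t = 1 \<and> weights N W' t = 1 / 2 \<or> weights N W t = 1 / 2 \<and> weights N W' t = 1"
proof -
  from assms(3) obtain t where t: "t \<in> W \<and> t \<notin> W' \<or> t \<notin> W \<and> t \<in> W'" by blast
  then have "t \<in> {2 * N + 1..<n}" using assms by auto
  with t show ?thesis by (intro that[of t]) (auto simp: weights_def)
qed

text \<open>With \<open>N = n div 4\<close> about half of the strategies are literals, giving linear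
  degree, and about half carry free weights, giving the exponent.\<close>

lemma game_family:
  fixes n :: nat
  defines "N \<equiv> n div 4"
  assumes n: "1000 \<le> n"
  shows "\<exists>G :: nat \<Rightarrow> game.
        (\<forall>i \<in> {1..2 ^ (n - 2 * N - 1)}. is_game n (G i) \<and> payoffs_in {-1..1} (G i)) \<and>
        (\<exists>d \<mu>. real d \<ge> 1 / 100 * real n \<and>
          pseudo_distribution (2 * n) d \<mu> \<and>
          (\<forall>i \<in> {1..2 ^ (n - 2 * N - 1)}. pseudo_equilibrium n d (G i) \<mu>)) \<and>
        (\<forall>i \<in> {1..2 ^ (n - 2 * N - 1)}. \<forall>j \<in> {1..2 ^ (n - 2 * N - 1)}. i \<noteq> j \<longrightarrow>
          (\<forall>x y x' y'.
            eps_NE n (1 / 2000 / real n ^ 4) (G i) x y \<longrightarrow>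
            eps_NE n (1 / 2000 / real n ^ 4) (G j) x' y' \<longrightarrow>
            x \<noteq> x' \<and> y \<noteq> y'))"
proof -
  define \<epsilon> where "\<epsilon> = 1 / 2000 / real n ^ 4"
  \<comment> \<open>At distance at least 1/2 from every integer, and near \<open>N / 2\<close> so
    that both \<open>r\<close> and \<open>N - r\<close> allow linear degree.\<close>
  define r where "r = real (N div 2) + 1 / 2"
  \<comment> \<open>One below \<open>N div 8\<close>, since \<open>satisfies_ge0I\<close> works in
    degree \<open>Suc d\<close>.\<close>
  define d where "d = N div 8 - 1"
  have N: "2 \<le> N" "0 < N" "2 * N + 2 \<le> n" "2 * N \<le> n" using n by (auto simp: N_def)
  have r: "0 \<le> r" "r \<le> real N"
    using N by (auto simp: r_def)
  have gap: "1 / 2 \<le> \<bar>real K - r\<bar>" for K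
  proof (cases "K \<le> N div 2")
    case True
    then have "real K \<le> real (N div 2)" by (rule of_nat_mono)
    then show ?thesis by (simp add: r_def)
  next
    case False
    then have "real (N div 2 + 1) \<le> real K" by (intro of_nat_mono) auto
    then show ?thesis by (simp add: r_def)
  qed
  have Sd: "Suc d = N div 8" using n by (simp add: d_def N_def)
  have d: "2 * real (Suc d) \<le> r" "real (Suc d) \<le> real N - r"
  proof -
    define u v where "u = N div 8" and "v = N div 2"
    have "8 * u \<le> N" "2 * v \<le> N" "N < 2 * v + 2"
      unfolding u_def v_def using dividend_less_times_div[of 2 N] by simp_all
    then have "2 * u \<le> v" "2 * u + 2 * v + 1 \<le> 2 * N"
      using N(1) by linarith+
    then have "real (2 * Suc d) \<le> real (N div 2)" "real (2 * Suc d + 2 * (N div 2) + 1) \<le> real (2 * N)"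
      by (simp_all only: of_nat_le_iff Sd u_def v_def)
    then show "2 * real (Suc d) \<le> r" "real (Suc d) \<le> real N - r"
      unfolding r_def by auto
  qed
  \<comment> \<open>\<open>2 * d\<close> is about \<open>n / 16\<close>; the slack down to
    \<open>n / 100\<close> absorbs the roundings.\<close>
  have d_large: "1 / 100 * real n \<le> real (2 * d)"
  proof -
    have "n \<le> 100 * (2 * d)" using n by (simp add: d_def N_def)
    then have "real n \<le> real (100 * (2 * d))" by (rule of_nat_mono)
    then show ?thesis by simp
  qed
  have n1: "1 \<le> real n" using n by simp
  have eps: "0 < \<epsilon>" "200 * real N ^ 3 * \<epsilon> \<le> 1" "1200 * real n ^ 2 * \<epsilon> \<le> 1"
  proof -
    show "0 < \<epsilon>" using n1 by (simp add: \<epsilon>_def)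
    have "real N ^ 3 \<le> real n ^ 3" unfolding N_def by (intro power_mono of_nat_mono) auto
    also have "\<dots> \<le> real n ^ 4" using n1 by (intro power_increasing) auto
    finally have "real N ^ 3 \<le> real n ^ 4" .
    then have "200 * real N ^ 3 \<le> 2000 * real n ^ 4" using zero_le_power[of "real n" 4] by linarith
    then show "200 * real N ^ 3 * \<epsilon> \<le> 1" using n1 by (simp add: \<epsilon>_def divide_le_eq)
    have "real n ^ 2 \<le> real n ^ 4" using n1 by (intro power_increasing) auto
    then have "1200 * real n ^ 2 \<le> 2000 * real n ^ 4" using zero_le_power[of "real n" 4] by linarith
    then show "1200 * real n ^ 2 * \<epsilon> \<le> 1" using n1 by (simp add: \<epsilon>_def divide_le_eq)
  qed
  have w: "1 / 2 \<le> weights N W k" "weights N W k \<le> 1" "0 \<le> weights N W k" for W k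
    by (auto simp: weights_def)
  interpret knapsack N r .
  have card: "card (Pow {2 * N + 1..<n}) = 2 ^ (n - 2 * N - 1)"
    by (simp add: card_Pow)
  have "finite (Pow {2 * N + 1..<n})" by simp
  from ex_bij_betw_nat_finite_1[OF this, unfolded card]
  obtain h :: "nat \<Rightarrow> nat set" where h: "bij_betw h {1..2 ^ (n - 2 * N - 1)} (Pow {2 * N + 1..<n})"
    by (elim exE)
  define G where "G i = knapsack_game n N r (weights N (h i))" for i
  have pe: "pseudo_equilibrium n (2 * d) (G i) (pseudo_dist n)" for i
    unfolding G_def by (rule pseudo_equilibrium_knapsack_game[OF N(2,4) d])
  have distinct: "x \<noteq> x' \<and> y \<noteq> y'"
    if ij: "i \<in> {1..2 ^ (n - 2 * N - 1)}" "j \<in> {1..2 ^ (n - 2 * N - 1)}" "i \<noteq> j"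
      and NE: "eps_NE n \<epsilon> (G i) x y" "eps_NE n \<epsilon> (G j) x' y'" for i j x y x' y'
  proof -
    have "h i \<in> Pow {2 * N + 1..<n}" "h j \<in> Pow {2 * N + 1..<n}" "h i \<noteq> h j"
      using h ij by (auto simp: bij_betw_def inj_on_def)
    then obtain t where t: "t \<in> {2 * N..<n}"
      "weights N (h i) t = 1 \<and> weights N (h j) t = 1 / 2 \<or> weights N (h i) t = 1 / 2 \<and> weights N (h j) t = 1"
      by (rule weights_differ)
    have ref: "weights N (h i) (2 * N) = weights N (h j) (2 * N)" by (simp add: weights_def)
    note ae = approx_equilibrium_of_eps_NE[OF NE(1)[unfolded G_def] N(2,3) r eps(1,2) w(1,2)]
      approx_equilibrium_of_eps_NE[OF NE(2)[unfolded G_def] N(2,3) r eps(1,2) w(1,2)]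
    show ?thesis
      using approx_equilibria_distinct[OF ae gap eps(3) ref t] by auto
  qed
  have "is_game n (G i) \<and> payoffs_in {-1..1} (G i)" for i
    unfolding G_def by (intro conjI is_game_knapsack_game payoffs_in_knapsack_game[OF N(1) r] w)
  moreover have "pseudo_distribution (2 * n) (2 * d) (pseudo_dist n)"
    using pe[of 0] unfolding pseudo_equilibrium_def by (rule conjunct1)
  ultimately show ?thesis
    unfolding \<epsilon>_def[symmetric] using pe d_large distinct by blast
qed

theorem mainTheorem2:
  shows "\<exists>c\<^sub>1 c\<^sub>2 c\<^sub>3 :: real. \<exists>\<Gamma> :: nat \<Rightarrow> nat.
    c\<^sub>1 > 0 \<and> c\<^sub>2 > 0 \<and> c\<^sub>3 > 0 \<and>
    (\<lambda>n. log 2 (real (\<Gamma> n))) \<in> \<Theta>(\<lambda>n. real n) \<and>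
    (\<forall>\<^sub>F n in sequentially.
      real (\<Gamma> n) \<ge> 2 powr (c\<^sub>1 * real n) \<and>
      (\<exists>G :: nat \<Rightarrow> game.
        (\<forall>i \<in> {1..\<Gamma> n}. is_game n (G i) \<and> payoffs_in {-1..1} (G i)) \<and>
        (\<exists>d \<mu>. real d \<ge> c\<^sub>2 * real n \<and>
          pseudo_distribution (2 * n) d \<mu> \<and>
          (\<forall>i \<in> {1..\<Gamma> n}. pseudo_equilibrium n d (G i) \<mu>)) \<and>
        (\<forall>i \<in> {1..\<Gamma> n}. \<forall>j \<in> {1..\<Gamma> n}. i \<noteq> j \<longrightarrow>
          (\<forall>x y x' y'.
            eps_NE n (c\<^sub>3 / real n ^ 4) (G i) x y \<longrightarrow>
            eps_NE n (c\<^sub>3 / real n ^ 4) (G j) x' y' \<longrightarrow>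
            x \<noteq> x' \<and> y \<noteq> y'))))"
proof -
  define \<Gamma> where "\<Gamma> n = (2 ^ (n - 2 * (n div 4) - 1) :: nat)" for n :: nat
  \<comment> \<open>The exponent is at least \<open>n / 2 - 1\<close>, whence the constant
    1/4.\<close>
  have exponent: "1 / 4 * real n \<le> real (n - 2 * (n div 4) - 1)" if "1000 \<le> n" for n
  proof -
    have "4 * (n div 4) \<le> n" by simp
    then have "n \<le> 4 * (n - 2 * (n div 4) - 1)" using that by linarith
    then have "real n \<le> real (4 * (n - 2 * (n div 4) - 1))" by (rule of_nat_mono)
    then show ?thesis by simp
  qed
  have log_\<Gamma>: "log 2 (real (\<Gamma> n)) = real (n - 2 * (n div 4) - 1)" for n
    by (simp add: \<Gamma>_def log_nat_power)
  have theta: "(\<lambda>n. log 2 (real (\<Gamma> n))) \<in> \<Theta>(\<lambda>n. real n)"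
  proof (rule bigthetaI'[of "1 / 4" 1])
    show "\<forall>\<^sub>F n in sequentially. 1 / 4 * norm (real n) \<le> norm (log 2 (real (\<Gamma> n))) \<and>
        norm (log 2 (real (\<Gamma> n))) \<le> 1 * norm (real n)"
      unfolding log_\<Gamma> using eventually_ge_at_top[of 1000]
    proof eventually_elim
      case (elim n)
      have "real (n - 2 * (n div 4) - 1) \<le> real n" by (intro of_nat_mono) simp
      with exponent[OF elim] show ?case by simp
    qed
  qed auto
  have size: "2 powr (1 / 4 * real n) \<le> real (\<Gamma> n)" if "1000 \<le> n" for n
  proof -
    have "2 powr (1 / 4 * real n) \<le> 2 powr real (n - 2 * (n div 4) - 1)"
      using exponent[OF that] by (intro powr_mono) auto
    then show ?thesis by (simp add: \<Gamma>_def powr_realpow)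
  qed
  show ?thesis
  proof (rule exI[of _ "1 / 4"], rule exI[of _ "1 / 100"], rule exI[of _ "1 / 2000"],
      rule exI[of _ \<Gamma>], intro conjI eventually_mono[OF eventually_ge_at_top[of 1000]])
    fix n :: nat assume n: "1000 \<le> n"
    from size[OF n] show "2 powr (1 / 4 * real n) \<le> real (\<Gamma> n)" .
    from game_family[OF n] show "\<exists>G :: nat \<Rightarrow> game.
        (\<forall>i \<in> {1..\<Gamma> n}. is_game n (G i) \<and> payoffs_in {-1..1} (G i)) \<and>
        (\<exists>d \<mu>. real d \<ge> 1 / 100 * real n \<and>
          pseudo_distribution (2 * n) d \<mu> \<and>
          (\<forall>i \<in> {1..\<Gamma> n}. pseudo_equilibrium n d (G i) \<mu>)) \<and>
        (\<forall>i \<in> {1..\<Gamma> n}. \<forall>j \<in> {1..\<Gamma> n}. i \<noteq> j \<longrightarrow>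
          (\<forall>x y x' y'.
            eps_NE n (1 / 2000 / real n ^ 4) (G i) x y \<longrightarrow>
            eps_NE n (1 / 2000 / real n ^ 4) (G j) x' y' \<longrightarrow>
            x \<noteq> x' \<and> y \<noteq> y'))"
      unfolding \<Gamma>_def .
  qed (simp_all add: theta)
qed

end
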